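(* Let $(R,\mathfrak m)$ be a commutative noetherian local ring of dimension $d>0$ and let $M\neq 0$ be an $R$-module of finite length and of infinite projective dimension. Then, for every $r\ge 0$, the following conditions are equivalent: (i) $\operatorname{Supp}(\operatorname{Syz}_{r+1}(M))=\operatorname{Spec}(R)$; (ii) $\dim(\operatorname{Syz}_{r+1}(M))=\dim R$; (iii) $\lambda(\operatorname{Syz}_{r+1}(M))=\infty$.
   Context: $\lambda(-)$ denotes length. For a finitely generated module $M$ over a local ring $R$, let $\cdots\to R^{\beta_{i+1}}\xrightarrow{f_{i+1}}R^{\beta_i}\xrightarrow{f_i}\cdots\to R^{\beta_0}\xrightarrow{f_0}M\to 0$ be the minimal free resolution. For $i>0$, $\operatorname{Syz}_i(M):=\operatorname{coker}(f_{i+1})=\ker(f_{i-1})$ is the $i$-th syzygy module. *)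

theory Defs
  imports
    "HOL-Algebra.Algebra"
    "HOL-Library.Extended_Nat"
    "HOL-Library.Extended_Real"
begin

section \<open>Rings\<close>

definition local_ring :: "('a, 'r) ring_scheme \<Rightarrow> 'a set \<Rightarrow> bool" where
  "local_ring R \<mm> \<longleftrightarrow> cring R \<and> maximalideal \<mm> R \<and> (\<forall>J. maximalideal J R \<longrightarrow> J = \<mm>)"

definition Spec :: "('a, 'r) ring_scheme \<Rightarrow> 'a set set" where
  "Spec R = {P. primeideal P R}"

text \<open>The values are extended reals so that the zero ring, which has no prime ideals, gets
  dimension \<open>-\<infinity>\<close> (the supremum of the empty set).\<close>

definition krull_dim :: "('a, 'r) ring_scheme \<Rightarrow> ereal" where
  "krull_dim R =
    (SUP n \<in> {n. \<exists>P. (\<forall>i\<le>n. P i \<in> Spec R) \<and> (\<forall>i<n. P i \<subset> P (Suc i))}. ereal (real n))"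


section \<open>Modules\<close>

definition mod_hom ::
  "('a, 'r) ring_scheme \<Rightarrow> ('a, 'b, 'm) module_scheme \<Rightarrow> ('a, 'c, 'n) module_scheme
    \<Rightarrow> ('b \<Rightarrow> 'c) set" where
  "mod_hom R M N = {f \<in> carrier M \<rightarrow> carrier N.
    (\<forall>x\<in>carrier M. \<forall>y\<in>carrier M. f (x \<oplus>\<^bsub>M\<^esub> y) = f x \<oplus>\<^bsub>N\<^esub> f y) \<and>
    (\<forall>a\<in>carrier R. \<forall>x\<in>carrier M. f (a \<odot>\<^bsub>M\<^esub> x) = a \<odot>\<^bsub>N\<^esub> f x)}"

definition mod_kernel ::
  "('a, 'b, 'm) module_scheme \<Rightarrow> ('a, 'c, 'n) module_scheme \<Rightarrow> ('b \<Rightarrow> 'c) \<Rightarrow> 'b set" where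
  "mod_kernel M N f = {x \<in> carrier M. f x = \<zero>\<^bsub>N\<^esub>}"

definition module_length :: "('a, 'r) ring_scheme \<Rightarrow> ('a, 'b, 'm) module_scheme \<Rightarrow> enat" where
  "module_length R M =
    (SUP n \<in> {n. \<exists>N. (\<forall>i\<le>n. submodule (N i) R M) \<and> (\<forall>i<n. N i \<subset> N (Suc i))}. enat n)"

definition annihilator :: "('a, 'r) ring_scheme \<Rightarrow> ('a, 'b, 'm) module_scheme \<Rightarrow> 'a set" where
  "annihilator R M = {a \<in> carrier R. \<forall>x\<in>carrier M. a \<odot>\<^bsub>M\<^esub> x = \<zero>\<^bsub>M\<^esub>}"

definition module_dim :: "('a, 'r) ring_scheme \<Rightarrow> ('a, 'b, 'm) module_scheme \<Rightarrow> ereal" where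
  "module_dim R M = krull_dim (R Quot (annihilator R M))"


subsection \<open>Localization at a prime and support\<close>

definition fraction_rel ::
  "('a, 'r) ring_scheme \<Rightarrow> 'a set \<Rightarrow> ('a, 'b, 'm) module_scheme \<Rightarrow> (('b \<times> 'a) \<times> ('b \<times> 'a)) set" where
  "fraction_rel R P M = {((x, s), (y, t)).
    x \<in> carrier M \<and> y \<in> carrier M \<and> s \<in> carrier R - P \<and> t \<in> carrier R - P \<and>
    (\<exists>u \<in> carrier R - P. u \<odot>\<^bsub>M\<^esub> (t \<odot>\<^bsub>M\<^esub> x) = u \<odot>\<^bsub>M\<^esub> (s \<odot>\<^bsub>M\<^esub> y))}"

text \<open>The localization \<open>M\<^sub>P\<close>, with the class of \<open>(x, s)\<close> for the fraction \<open>x / s\<close>, regarded as an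
  \<open>R\<close>-module. Here and below, the ring fields \<open>mult\<close> and \<open>one\<close> of the record type of modules carry
  no information.\<close>

definition localization ::
  "('a, 'r) ring_scheme \<Rightarrow> 'a set \<Rightarrow> ('a, 'b, 'm) module_scheme \<Rightarrow> ('a, ('b \<times> 'a) set) module" where
  "localization R P M =
    \<lparr>carrier = (carrier M \<times> (carrier R - P)) // fraction_rel R P M,
     monoid.mult = undefined,
     one = undefined,
     ring.zero = fraction_rel R P M `` {(\<zero>\<^bsub>M\<^esub>, \<one>\<^bsub>R\<^esub>)},
     add = (\<lambda>A B. \<Union>(x, s)\<in>A. \<Union>(y, t)\<in>B.
        fraction_rel R P M `` {((t \<odot>\<^bsub>M\<^esub> x) \<oplus>\<^bsub>M\<^esub> (s \<odot>\<^bsub>M\<^esub> y), s \<otimes>\<^bsub>R\<^esub> t)}),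
     smult = (\<lambda>a A. \<Union>(x, s)\<in>A. fraction_rel R P M `` {(a \<odot>\<^bsub>M\<^esub> x, s)})\<rparr>"

definition Supp :: "('a, 'r) ring_scheme \<Rightarrow> ('a, 'b, 'm) module_scheme \<Rightarrow> 'a set set" where
  "Supp R M = {P \<in> Spec R. carrier (localization R P M) \<noteq> {\<zero>\<^bsub>localization R P M\<^esub>}}"


subsection \<open>Resolutions\<close>

text \<open>\<open>\<cdots> \<rightarrow> F 2 \<rightarrow> F 1 \<rightarrow> F 0 \<rightarrow> M \<rightarrow> 0\<close> is exact, where \<open>e : F 0 \<rightarrow> M\<close> is the augmentation and
  \<open>f i : F i \<rightarrow> F (i - 1)\<close> for \<open>i \<ge> 1\<close>; the value \<open>f 0\<close> is not used, because \<open>e\<close> has a different type.\<close>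

definition resolution ::
  "('a, 'r) ring_scheme \<Rightarrow> ('a, 'b, 'm) module_scheme \<Rightarrow> (nat \<Rightarrow> ('a, 'c) module)
    \<Rightarrow> ('c \<Rightarrow> 'b) \<Rightarrow> (nat \<Rightarrow> 'c \<Rightarrow> 'c) \<Rightarrow> bool" where
  "resolution R M F e f \<longleftrightarrow>
    (\<forall>i. module R (F i)) \<and>
    e \<in> mod_hom R (F 0) M \<and>
    (\<forall>i\<ge>1. f i \<in> mod_hom R (F i) (F (i - 1))) \<and>
    e ` carrier (F 0) = carrier M \<and>
    f 1 ` carrier (F 1) = mod_kernel (F 0) M e \<and>
    (\<forall>i\<ge>1. f (i + 1) ` carrier (F (i + 1)) = mod_kernel (F i) (F (i - 1)) (f i))"

text \<open>The lifting property. HOL cannot quantify over modules of all types inside a formula, but no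
  generality is lost: it suffices to lift the identity of \<open>P\<close> along the canonical surjection
  \<open>R\<^bsup>(P)\<^esup> \<rightarrow> P\<close>, and both modules have copies with carrier in \<open>('a + 'p) list\<close>, a type of cardinality
  \<open>max |'a| |'p| \<aleph>\<^sub>0\<close>.\<close>

definition projective_module :: "('a, 'r) ring_scheme \<Rightarrow> ('a, 'p, 'm) module_scheme \<Rightarrow> bool" where
  "projective_module R P \<longleftrightarrow> module R P \<and>
    (\<forall>(N :: ('a, ('a + 'p) list) module) (N' :: ('a, ('a + 'p) list) module) g h.
      module R N \<longrightarrow> module R N' \<longrightarrow>
      g \<in> mod_hom R N N' \<longrightarrow> g ` carrier N = carrier N' \<longrightarrow> h \<in> mod_hom R P N' \<longrightarrow>
      (\<exists>k \<in> mod_hom R P N. \<forall>x\<in>carrier P. g (k x) = h x))"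

text \<open>A projective resolution has length at most \<open>n\<close> if its modules vanish beyond degree \<open>n\<close>. As above,
  restricting to modules with carrier in \<open>('a + 'b) list\<close> loses nothing: if \<open>M\<close> has a projective
  resolution of length at most \<open>n\<close>, then in any free resolution of \<open>M\<close> by modules of cardinality at
  most \<open>max |'a| |'b| \<aleph>\<^sub>0\<close> the \<open>n\<close>-th syzygy is projective. If there is none of finite length, the
  infimum is \<open>\<infinity>\<close>.\<close>

definition proj_dim :: "('a, 'r) ring_scheme \<Rightarrow> ('a, 'b, 'm) module_scheme \<Rightarrow> enat" where
  "proj_dim R M =
    (INF n \<in> {n. \<exists>(P :: nat \<Rightarrow> ('a, ('a + 'b) list) module) e f.
        resolution R M P e f \<and> (\<forall>i. projective_module R (P i)) \<and>
        (\<forall>i>n. carrier (P i) = {\<zero>\<^bsub>P i\<^esub>})}. enat n)"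

definition free_module :: "('a, 'r) ring_scheme \<Rightarrow> nat \<Rightarrow> ('a, nat \<Rightarrow> 'a) module" where
  "free_module R n =
    \<lparr>carrier = {..<n} \<rightarrow>\<^sub>E carrier R,
     monoid.mult = undefined,
     one = undefined,
     ring.zero = (\<lambda>j\<in>{..<n}. \<zero>\<^bsub>R\<^esub>),
     add = (\<lambda>x y. \<lambda>j\<in>{..<n}. x j \<oplus>\<^bsub>R\<^esub> y j),
     smult = (\<lambda>a x. \<lambda>j\<in>{..<n}. a \<otimes>\<^bsub>R\<^esub> x j)\<rparr>"

text \<open>Minimality: \<open>f i\<close> maps \<open>R\<^bsup>\<beta> i\<^esup>\<close> into \<open>\<mm> R\<^bsup>\<beta> (i - 1)\<^esup>\<close>, the vectors with all entries in \<open>\<mm>\<close>.\<close>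

definition minimal_free_resolution ::
  "('a, 'r) ring_scheme \<Rightarrow> 'a set \<Rightarrow> ('a, 'b, 'm) module_scheme \<Rightarrow> (nat \<Rightarrow> nat)
    \<Rightarrow> ((nat \<Rightarrow> 'a) \<Rightarrow> 'b) \<Rightarrow> (nat \<Rightarrow> (nat \<Rightarrow> 'a) \<Rightarrow> (nat \<Rightarrow> 'a)) \<Rightarrow> bool" where
  "minimal_free_resolution R \<mm> M \<beta> e f \<longleftrightarrow>
    resolution R M (\<lambda>i. free_module R (\<beta> i)) e f \<and>
    (\<forall>i\<ge>1. \<forall>x \<in> carrier (free_module R (\<beta> i)). \<forall>j<\<beta> (i - 1). f i x j \<in> \<mm>)"

text \<open>The \<open>i\<close>-th syzygy module \<open>ker (f (i - 1)) \<subseteq> R\<^bsup>\<beta> (i - 1)\<^esup>\<close>, for \<open>i > 0\<close>, of \<open>M\<close> with respect to a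
  resolution as above; the augmentation \<open>e\<close> takes the role of \<open>f 0\<close>.\<close>

definition syzygy ::
  "('a, 'r) ring_scheme \<Rightarrow> ('a, 'b, 'm) module_scheme \<Rightarrow> (nat \<Rightarrow> nat)
    \<Rightarrow> ((nat \<Rightarrow> 'a) \<Rightarrow> 'b) \<Rightarrow> (nat \<Rightarrow> (nat \<Rightarrow> 'a) \<Rightarrow> (nat \<Rightarrow> 'a)) \<Rightarrow> nat
    \<Rightarrow> ('a, nat \<Rightarrow> 'a) module" where
  "syzygy R M \<beta> e f i =
    (free_module R (\<beta> (i - 1)))\<lparr>carrier :=
      (if i = 1 then mod_kernel (free_module R (\<beta> 0)) M e
       else mod_kernel (free_module R (\<beta> (i - 1))) (free_module R (\<beta> (i - 2))) (f (i - 1)))\<rparr>"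

end

theory Submission
  imports Defs
begin

text \<open>
  Write \<open>F\<^sub>i\<close> for the free modules of the resolution and \<open>S\<close> for the syzygy, the kernel of the map
  leaving \<open>F\<^sub>r\<close>. The point is that \<open>S\<close> has a rank which is the same at all primes \<open>P \<noteq> \<mm>\<close>: since \<open>M\<close>
  vanishes there, \<open>0 \<rightarrow> S \<rightarrow> F\<^sub>r \<rightarrow> \<cdots> \<rightarrow> F\<^sub>0 \<rightarrow> 0\<close> is split exact at \<open>P\<close>, and the rank is the alternating sum of
  the \<open>\<beta> i\<close>. So \<open>S\<close> vanishes at one prime other than \<open>\<mm>\<close> only if it vanishes at all of them, and then it
  has finite length.

  The proof avoids localized complexes. For \<open>s\<close> in the annihilator of \<open>M\<close>, multiplication by \<open>s\<close> is
  null-homotopic on the resolution: there are maps \<open>h : F\<^sub>i \<rightarrow> F\<^sub>i\<^sub>+\<^sub>1\<close> with \<open>f h + h f = s\<close>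
  (\<open>exists_null_homotopy\<close>). On the sum of \<open>F\<^sub>0, \<dots>, F\<^sub>r\<close> consider \<open>D = f + h\<close>, where \<open>h\<close> is dropped on \<open>F\<^sub>r\<close>. It
  exchanges the part \<open>E\<close> in the degrees congruent to \<open>r\<close> modulo 2 with the part \<open>O\<close> in the other degrees,
  and \<open>D\<^sup>2\<close> is \<open>s + h\<^sup>2\<close> except in degree \<open>r\<close>, where an error with values in \<open>S\<close> is subtracted. As \<open>h\<^sup>2\<close>
  raises degrees, \<open>D\<^sup>2\<close> is triangular with \<open>s\<close> on the diagonal, up to this error.
  \<^item> If \<open>S\<close> vanishes at a prime \<open>P\<close> with \<open>s \<notin> P\<close>, the error is invisible at \<open>P\<close>. Hence \<open>D\<close> is injective
    from \<open>E\<close> to \<open>O\<close> modulo \<open>P\<close>, and elimination over the domain \<open>R/P\<close> gives \<open>rank E \<le> rank O\<close>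
    (\<open>card_parity_le\<close>).
  \<^item> On \<open>O\<close> there is no error, so \<open>D\<close> maps \<open>E\<close> onto \<open>O\<close> after inverting \<open>s\<close>. Over a
    noetherian ring, a surjection onto a free module of at least the same rank is injective. So, if \<open>rank E \<le> rank O\<close>, the kernel of
    \<open>D\<close> on \<open>E\<close>, which contains \<open>S\<close>, is killed by a power of \<open>s\<close> (\<open>cycle_torsion\<close>).

  The inequality between the ranks mentions neither \<open>s\<close> nor \<open>P\<close>. Since \<open>M\<close> has finite length, a power of
  each element of \<open>\<mm>\<close> annihilates \<open>M\<close> (\<open>finite_length_nilpotent\<close>), and therefore a power of it annihilates
  \<open>S\<close> as soon as the support of \<open>S\<close> misses one prime (\<open>syzygy_torsion_of_not_in_Supp\<close>). Then \<open>S\<close> has finite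
  length (\<open>nilpotent_imp_finite_length\<close>), which shows that (iii) implies (i). If the support is everything,
  the annihilator of \<open>S\<close> lies in all primes and dividing by it preserves the dimension; thus (i) implies
  (ii). If \<open>S\<close> has finite length, its annihilator contains powers of all elements of \<open>\<mm>\<close>, so the
  quotient has dimension at most 0, which is less than \<open>d\<close>; thus (ii) implies (iii).
\<close>

section \<open>Linear maps\<close>

lemma mod_homD:
  assumes "f \<in> mod_hom R M N"
  shows "x \<in> carrier M \<Longrightarrow> f x \<in> carrier N"
    and "x \<in> carrier M \<Longrightarrow> y \<in> carrier M \<Longrightarrow> f (x \<oplus>\<^bsub>M\<^esub> y) = f x \<oplus>\<^bsub>N\<^esub> f y"
    and "a \<in> carrier R \<Longrightarrow> x \<in> carrier M \<Longrightarrow> f (a \<odot>\<^bsub>M\<^esub> x) = a \<odot>\<^bsub>N\<^esub> f x"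
  using assms by (auto simp: mod_hom_def)

lemma mod_homI:
  assumes "\<And>x. x \<in> carrier M \<Longrightarrow> f x \<in> carrier N"
    and "\<And>x y. x \<in> carrier M \<Longrightarrow> y \<in> carrier M \<Longrightarrow> f (x \<oplus>\<^bsub>M\<^esub> y) = f x \<oplus>\<^bsub>N\<^esub> f y"
    and "\<And>a x. a \<in> carrier R \<Longrightarrow> x \<in> carrier M \<Longrightarrow> f (a \<odot>\<^bsub>M\<^esub> x) = a \<odot>\<^bsub>N\<^esub> f x"
  shows "f \<in> mod_hom R M N"
  using assms by (auto simp: mod_hom_def)

lemma mod_hom_comp:
  assumes "f \<in> mod_hom R M N" "g \<in> mod_hom R N L"
  shows "(\<lambda>x. g (f x)) \<in> mod_hom R M L"
  using assms by (auto simp: mod_hom_def Pi_iff)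

lemma mod_hom_zero:
  assumes "module R M" "module R N" "f \<in> mod_hom R M N"
  shows "f \<zero>\<^bsub>M\<^esub> = \<zero>\<^bsub>N\<^esub>"
proof -
  interpret M: module R M by fact
  interpret N: module R N by fact
  have "f \<zero>\<^bsub>M\<^esub> = f (\<zero>\<^bsub>R\<^esub> \<odot>\<^bsub>M\<^esub> \<zero>\<^bsub>M\<^esub>)" by simp
  also have "\<dots> = \<zero>\<^bsub>R\<^esub> \<odot>\<^bsub>N\<^esub> f \<zero>\<^bsub>M\<^esub>" by (rule mod_homD(3)[OF assms(3)]) simp_all
  also have "\<dots> = \<zero>\<^bsub>N\<^esub>" using mod_homD(1)[OF assms(3)] by simp
  finally show ?thesis .
qed

lemma mod_hom_minus:
  assumes "module R M" "module R N" "f \<in> mod_hom R M N" "x \<in> carrier M" "y \<in> carrier M"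
  shows "f (x \<ominus>\<^bsub>M\<^esub> y) = f x \<ominus>\<^bsub>N\<^esub> f y"
proof -
  interpret M: module R M by fact
  interpret N: module R N by fact
  have y: "\<ominus>\<^bsub>M\<^esub> y = (\<ominus>\<^bsub>R\<^esub> \<one>\<^bsub>R\<^esub>) \<odot>\<^bsub>M\<^esub> y" using assms(5) by (simp add: M.smult_l_minus)
  have "f (\<ominus>\<^bsub>M\<^esub> y) = (\<ominus>\<^bsub>R\<^esub> \<one>\<^bsub>R\<^esub>) \<odot>\<^bsub>N\<^esub> f y"
    unfolding y using assms by (simp add: mod_homD(3))
  also have "\<dots> = \<ominus>\<^bsub>N\<^esub> f y" using mod_homD(1)[OF assms(3,5)] by (simp add: N.smult_l_minus)
  finally show ?thesis using assms by (simp add: a_minus_def mod_homD(2))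
qed

lemma mod_hom_add:
  assumes "module R M" "module R N" "f \<in> mod_hom R M N" "g \<in> mod_hom R M N"
  shows "(\<lambda>x. f x \<oplus>\<^bsub>N\<^esub> g x) \<in> mod_hom R M N"
proof -
  interpret M: module R M by fact
  interpret N: module R N by fact
  note f = mod_homD[OF assms(3)] and g = mod_homD[OF assms(4)]
  show ?thesis
    by (rule mod_homI) (simp_all add: f g N.a_ac N.smult_r_distr)
qed

lemma mod_hom_smult:
  assumes "module R M" "module R N" "f \<in> mod_hom R M N" "a \<in> carrier R"
  shows "(\<lambda>x. a \<odot>\<^bsub>N\<^esub> f x) \<in> mod_hom R M N"
proof -
  interpret M: module R M by fact
  interpret N: module R N by fact
  note f = mod_homD[OF assms(3)]
  show ?thesis
    by (rule mod_homI) (use assms(4) in \<open>simp_all add: f N.smult_r_distr flip: N.smult_assoc1\<close>,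
        simp add: M.R.m_comm)
qed

lemma submodule_kernel:
  assumes "module R M" "module R N" "f \<in> mod_hom R M N"
  shows "submodule (mod_kernel M N f) R M"
proof -
  interpret M: module R M by fact
  interpret N: module R N by fact
  note f = mod_homD[OF assms(3)]
  have "f (\<ominus>\<^bsub>M\<^esub> x) = \<zero>\<^bsub>N\<^esub>" if "x \<in> carrier M" "f x = \<zero>\<^bsub>N\<^esub>" for x
    using mod_hom_minus[OF assms, of "\<zero>\<^bsub>M\<^esub>" x] mod_hom_zero[OF assms] that by (simp add: a_minus_def)
  then show ?thesis
    by (intro M.submoduleI) (auto simp: mod_kernel_def f mod_hom_zero[OF assms])
qed

section \<open>Free modules of finite rank\<close>

text \<open>Index sets are arbitrary, so that a direct sum of free modules can again be one of these.\<close>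

definition free_on :: "('a, 'r) ring_scheme \<Rightarrow> 'i set \<Rightarrow> ('a, 'i \<Rightarrow> 'a) module" where
  "free_on R I =
    \<lparr>carrier = I \<rightarrow>\<^sub>E carrier R,
     monoid.mult = undefined,
     one = undefined,
     ring.zero = (\<lambda>j\<in>I. \<zero>\<^bsub>R\<^esub>),
     add = (\<lambda>x y. \<lambda>j\<in>I. x j \<oplus>\<^bsub>R\<^esub> y j),
     smult = (\<lambda>a x. \<lambda>j\<in>I. a \<otimes>\<^bsub>R\<^esub> x j)\<rparr>"

definition basis_vec :: "('a, 'r) ring_scheme \<Rightarrow> 'i set \<Rightarrow> 'i \<Rightarrow> 'i \<Rightarrow> 'a" where
  "basis_vec R I i = (\<lambda>j\<in>I. if j = i then \<one>\<^bsub>R\<^esub> else \<zero>\<^bsub>R\<^esub>)"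

lemma free_module_eq: "free_module R n = free_on R {..<n}"
  by (simp add: free_module_def free_on_def)

lemma free_on_simps:
  "carrier (free_on R I) = I \<rightarrow>\<^sub>E carrier R"
  "\<zero>\<^bsub>free_on R I\<^esub> = (\<lambda>j\<in>I. \<zero>\<^bsub>R\<^esub>)"
  "x \<oplus>\<^bsub>free_on R I\<^esub> y = (\<lambda>j\<in>I. x j \<oplus>\<^bsub>R\<^esub> y j)"
  "a \<odot>\<^bsub>free_on R I\<^esub> x = (\<lambda>j\<in>I. a \<otimes>\<^bsub>R\<^esub> x j)"
  by (simp_all add: free_on_def)

lemma free_on_eqI:
  assumes "x \<in> carrier (free_on R I)" "y \<in> carrier (free_on R I)" "\<And>i. i \<in> I \<Longrightarrow> x i = y i"
  shows "x = y"
  using assms by (auto simp: free_on_simps intro: PiE_ext)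

context cring begin

lemma free_on_module: "module R (free_on R I)"
proof (intro moduleI abelian_groupI)
  show "cring R" by (rule is_cring)
  show "\<exists>y\<in>carrier (free_on R I). y \<oplus>\<^bsub>free_on R I\<^esub> x = \<zero>\<^bsub>free_on R I\<^esub>"
    if x: "x \<in> carrier (free_on R I)" for x
  proof (rule bexI[of _ "\<lambda>j\<in>I. \<ominus> x j"])
    show "(\<lambda>j\<in>I. \<ominus> x j) \<oplus>\<^bsub>free_on R I\<^esub> x = \<zero>\<^bsub>free_on R I\<^esub>"
      using x by (auto simp: free_on_simps PiE_iff l_neg intro!: restrict_ext)
  qed (use x in \<open>auto simp: free_on_simps\<close>)
qed (auto simp: free_on_simps PiE_iff a_ac m_ac l_distr r_distr extensional_def
    intro!: restrict_ext)

lemma free_on_index: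
  assumes "i \<in> I"
  shows "\<zero>\<^bsub>free_on R I\<^esub> i = \<zero>"
    and "(x \<oplus>\<^bsub>free_on R I\<^esub> y) i = x i \<oplus> y i"
    and "(a \<odot>\<^bsub>free_on R I\<^esub> x) i = a \<otimes> x i"
    and "x \<in> carrier (free_on R I) \<Longrightarrow> x i \<in> carrier R"
  using assms by (auto simp: free_on_simps)

lemma free_on_minus_index:
  assumes "x \<in> carrier (free_on R I)" "y \<in> carrier (free_on R I)" "i \<in> I"
  shows "(x \<ominus>\<^bsub>free_on R I\<^esub> y) i = x i \<ominus> y i"
proof -
  interpret F: module R "free_on R I" by (rule free_on_module)
  have "\<ominus>\<^bsub>free_on R I\<^esub> y = (\<ominus> \<one>) \<odot>\<^bsub>free_on R I\<^esub> y" using assms(2) by (simp add: F.smult_l_minus)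
  then show ?thesis
    using assms by (simp add: a_minus_def free_on_index l_minus)
qed

lemma basis_vec_closed: "basis_vec R I i \<in> carrier (free_on R I)"
  by (auto simp: basis_vec_def free_on_simps)

text \<open>A vector is the sum of its components along the basis; this replaces explicit finite sums.\<close>

lemma free_on_induct [consumes 2, case_names zero add basis]:
  assumes I: "finite I" and x: "x \<in> carrier (free_on R I)"
    and zero: "Q \<zero>\<^bsub>free_on R I\<^esub>"
    and add: "\<And>y z. y \<in> carrier (free_on R I) \<Longrightarrow> z \<in> carrier (free_on R I) \<Longrightarrow> Q y \<Longrightarrow> Q z
      \<Longrightarrow> Q (y \<oplus>\<^bsub>free_on R I\<^esub> z)"
    and basis: "\<And>i. i \<in> I \<Longrightarrow> Q (x i \<odot>\<^bsub>free_on R I\<^esub> basis_vec R I i)"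
  shows "Q x"
proof -
  interpret F: module R "free_on R I" by (rule free_on_module)
  let ?t = "\<lambda>K. \<lambda>i\<in>I. if i \<in> K then x i else \<zero>"
  have xc: "x i \<in> carrier R" if "i \<in> I" for i using x that by (auto simp: free_on_simps)
  have tc: "?t K \<in> carrier (free_on R I)" for K by (auto simp: free_on_simps xc)
  have "Q (?t K)" if "finite K" "K \<subseteq> I" for K
    using that
  proof (induction K rule: finite_induct)
    case empty
    then show ?case using zero by (simp add: free_on_simps restrict_def)
  next
    case (insert k K)
    have k: "k \<in> I" using insert by auto
    have eq: "?t (insert k K) = ?t K \<oplus>\<^bsub>free_on R I\<^esub> (x k \<odot>\<^bsub>free_on R I\<^esub> basis_vec R I k)"
      using insert.hyps(2) k by (auto simp: free_on_simps basis_vec_def xc intro!: restrict_ext)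
    have "Q (?t K)" using insert by blast
    then show ?case unfolding eq
      using k by (intro add tc basis F.smult_closed basis_vec_closed xc)
  qed
  then have "Q (?t I)" using I by blast
  moreover have "?t I = x" using x by (intro free_on_eqI[OF tc]) auto
  ultimately show ?thesis by simp
qed

text \<open>Free modules are projective: preimages of the basis vectors may be chosen freely.\<close>

lemma free_on_lift:
  assumes I: "finite I" and M: "module R M" and N: "module R N"
    and f: "f \<in> mod_hom R M N" and g: "g \<in> mod_hom R (free_on R I) N"
    and im: "g ` carrier (free_on R I) \<subseteq> f ` carrier M"
  shows "\<exists>h \<in> mod_hom R (free_on R I) M. \<forall>x\<in>carrier (free_on R I). f (h x) = g x"
proof -
  interpret F: module R "free_on R I" by (rule free_on_module)
  interpret M: module R M by fact
  interpret N: module R N by fact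
  have "\<forall>i. \<exists>y. y \<in> carrier M \<and> f y = g (basis_vec R I i)"
    using im basis_vec_closed by (metis image_iff image_subset_iff)
  then obtain y where y: "\<And>i. y i \<in> carrier M" "\<And>i. f (y i) = g (basis_vec R I i)"
    by metis
  define h where "h = (\<lambda>x. \<Oplus>\<^bsub>M\<^esub>i\<in>I. x i \<odot>\<^bsub>M\<^esub> y i)"
  have c: "x i \<in> carrier R" if "x \<in> carrier (free_on R I)" "i \<in> I" for x i
    using that by (auto simp: free_on_simps)
  have h: "h \<in> mod_hom R (free_on R I) M"
  proof (rule mod_homI)
    show "h x \<in> carrier M" if "x \<in> carrier (free_on R I)" for x
      using that by (auto simp: h_def c y intro!: M.finsum_closed)
    show "h (x \<oplus>\<^bsub>free_on R I\<^esub> z) = h x \<oplus>\<^bsub>M\<^esub> h z"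
      if "x \<in> carrier (free_on R I)" "z \<in> carrier (free_on R I)" for x z
    proof -
      have "h (x \<oplus>\<^bsub>free_on R I\<^esub> z) = (\<Oplus>\<^bsub>M\<^esub>i\<in>I. x i \<odot>\<^bsub>M\<^esub> y i \<oplus>\<^bsub>M\<^esub> z i \<odot>\<^bsub>M\<^esub> y i)"
        unfolding h_def using that
        by (intro M.finsum_cong') (auto simp: free_on_index M.smult_l_distr c y)
      also have "\<dots> = h x \<oplus>\<^bsub>M\<^esub> h z"
        unfolding h_def using that by (intro M.finsum_addf) (auto simp: c y)
      finally show ?thesis .
    qed
    show "h (a \<odot>\<^bsub>free_on R I\<^esub> x) = a \<odot>\<^bsub>M\<^esub> h x"
      if "a \<in> carrier R" "x \<in> carrier (free_on R I)" for a x
    proof -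
      have "a \<odot>\<^bsub>M\<^esub> h x = (\<Oplus>\<^bsub>M\<^esub>i\<in>I. a \<odot>\<^bsub>M\<^esub> (x i \<odot>\<^bsub>M\<^esub> y i))"
        unfolding h_def using that by (intro M.finsum_smult_ldistr I) (auto simp: c y)
      also have "\<dots> = h (a \<odot>\<^bsub>free_on R I\<^esub> x)"
        unfolding h_def using that
        by (intro M.finsum_cong') (auto simp: free_on_index M.smult_assoc1 c y)
      finally show ?thesis ..
    qed
  qed
  note h' = mod_homD[OF h] and f' = mod_homD[OF f] and g' = mod_homD[OF g]
  have hb: "h (basis_vec R I i) = y i" if "i \<in> I" for i
  proof -
    have "h (basis_vec R I i) = (\<Oplus>\<^bsub>M\<^esub>j\<in>I. if i = j then y j else \<zero>\<^bsub>M\<^esub>)"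
      unfolding h_def by (intro M.finsum_cong') (auto simp: basis_vec_def y)
    also have "\<dots> = y i" using that I by (intro M.finsum_singleton) (auto simp: y)
    finally show ?thesis .
  qed
  have "f (h x) = g x" if x: "x \<in> carrier (free_on R I)" for x
    using I x
  proof (induction rule: free_on_induct)
    case zero
    show ?case
      by (simp add: mod_hom_zero[OF free_on_module M h] mod_hom_zero[OF M N f]
          mod_hom_zero[OF free_on_module N g])
  next
    case (add u v)
    then show ?case by (simp add: h' f' g')
  next
    case (basis i)
    then show ?case using x by (simp add: h' f' g' c basis_vec_closed hb y)
  qed
  then show ?thesis using h by blast
qed

end

section \<open>Noetherian modules\<close>

lemma (in noetherian_ring) noetherian_maximal_ideal:
  assumes "C \<noteq> {}" "\<And>I. I \<in> C \<Longrightarrow> ideal I R"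
  shows "\<exists>I\<in>C. \<forall>J\<in>C. I \<subseteq> J \<longrightarrow> J = I"
proof (rule subset_Zorn_nonempty[OF assms(1)])
  fix D assume D: "D \<noteq> {}" "subset.chain C D"
  then have "subset.chain {I. ideal I R} D"
    using assms(2) by (auto simp: pred_on.chain_def)
  then have "\<Union>D \<in> D" by (rule ideal_chain_is_trivial[OF D(1)])
  then show "\<Union>D \<in> C" using D(2) by (auto simp: pred_on.chain_def)
qed

context cring begin

text \<open>Induction on the set \<open>K\<close> of coordinates that may be nonzero, keeping the ambient module fixed.\<close>

lemma noetherian_maximal_submodule_aux:
  assumes noeth: "noetherian_ring R" and "finite K" "K \<subseteq> I" "C \<noteq> {}"
    and "\<And>N. N \<in> C \<Longrightarrow> submodule N R (free_on R I)"
    and "\<And>N x i. N \<in> C \<Longrightarrow> x \<in> N \<Longrightarrow> i \<in> I - K \<Longrightarrow> x i = \<zero>"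
  shows "\<exists>N\<in>C. \<forall>N'\<in>C. N \<subseteq> N' \<longrightarrow> N' = N"
  using assms(2-)
proof (induction K arbitrary: C rule: finite_induct)
  case empty
  interpret F: module R "free_on R I" by (rule free_on_module)
  have "N = {\<zero>\<^bsub>free_on R I\<^esub>}" if N: "N \<in> C" for N
  proof -
    have "x = \<zero>\<^bsub>free_on R I\<^esub>" if "x \<in> N" for x
      using empty.prems(4)[OF N that] F.submoduleE(1)[OF empty.prems(3)[OF N]] that
      by (intro free_on_eqI) (auto simp: free_on_index)
    then show ?thesis using F.submoduleE(2)[OF empty.prems(3)[OF N]] by auto
  qed
  then show ?case using empty.prems(2) by (metis ex_in_conv)
next
  case (insert k K)
  interpret F: module R "free_on R I" by (rule free_on_module)
  have k: "k \<in> I" using insert.prems by auto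
  \<comment> \<open>A submodule is determined, within any larger one, by its ideal of \<open>k\<close>-th coordinates and by
    its elements whose \<open>k\<close>-th coordinate vanishes.\<close>
  define p :: "('c \<Rightarrow> 'a) set \<Rightarrow> 'a set" where "p = (\<lambda>N. (\<lambda>x. x k) ` N)"
  define q :: "('c \<Rightarrow> 'a) set \<Rightarrow> ('c \<Rightarrow> 'a) set" where "q = (\<lambda>N. {x \<in> N. x k = \<zero>})"
  note sub = F.submoduleE[OF insert.prems(3)]
  have idx: "x k \<in> carrier R" if "N \<in> C" "x \<in> N" for N x
    using sub(1)[OF that(1)] that(2) k by (auto simp: free_on_index)
  have zero_in: "\<zero>\<^bsub>free_on R I\<^esub> \<in> N" if N: "N \<in> C" for N
  proof -
    obtain x where x: "x \<in> N" using sub(2)[OF N] by blast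
    have "\<zero> \<odot>\<^bsub>free_on R I\<^esub> x \<in> N" using sub(4)[OF N zero_closed x] .
    then show ?thesis using sub(1)[OF N] x by auto
  qed
  have "ideal (p N) R" if N: "N \<in> C" for N
  proof (rule idealI)
    show "ring R" by (rule ring_axioms)
    show "subgroup (p N) (add_monoid R)"
    proof (rule add.subgroupI)
      show "p N \<subseteq> carrier R" using idx[OF N] by (auto simp: p_def)
      show "p N \<noteq> {}" using sub(2)[OF N] by (auto simp: p_def)
      fix a b assume "a \<in> p N" "b \<in> p N"
      then obtain x y where xy: "x \<in> N" "a = x k" "y \<in> N" "b = y k" by (auto simp: p_def)
      have "x \<oplus>\<^bsub>free_on R I\<^esub> y \<in> N" using sub(5)[OF N] xy by blast
      moreover have "(x \<oplus>\<^bsub>free_on R I\<^esub> y) k = a \<oplus> b" using xy k by (simp add: free_on_index)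
      ultimately show "a \<oplus> b \<in> p N" unfolding p_def by (metis imageI)
      have "(\<ominus> \<one>) \<odot>\<^bsub>free_on R I\<^esub> x \<in> N" using sub(4)[OF N] xy by blast
      moreover have "((\<ominus> \<one>) \<odot>\<^bsub>free_on R I\<^esub> x) k = \<ominus> a"
        using xy k idx[OF N] by (simp add: free_on_index l_minus)
      ultimately show "\<ominus> a \<in> p N" unfolding p_def by (metis imageI)
    qed
    fix a c assume "a \<in> p N" and c: "c \<in> carrier R"
    then obtain x where x: "x \<in> N" "a = x k" by (auto simp: p_def)
    have "c \<odot>\<^bsub>free_on R I\<^esub> x \<in> N" using sub(4)[OF N] x c by blast
    moreover have "(c \<odot>\<^bsub>free_on R I\<^esub> x) k = c \<otimes> a" using x k by (simp add: free_on_index)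
    ultimately show "c \<otimes> a \<in> p N" unfolding p_def by (metis imageI)
    then show "a \<otimes> c \<in> p N" using x c idx[OF N] m_comm by metis
  qed
  then have "\<exists>J\<in>p ` C. \<forall>J'\<in>p ` C. J \<subseteq> J' \<longrightarrow> J' = J"
    using insert.prems(2) by (intro noetherian_ring.noetherian_maximal_ideal[OF noeth]) auto
  then obtain N0 where N0: "N0 \<in> C" "\<And>N'. N' \<in> C \<Longrightarrow> p N0 \<subseteq> p N' \<Longrightarrow> p N' = p N0" by auto
  define C2 where "C2 = {N \<in> C. p N = p N0}"
  have "\<exists>L\<in>q ` C2. \<forall>L'\<in>q ` C2. L \<subseteq> L' \<longrightarrow> L' = L"
  proof (rule insert.IH)
    show "K \<subseteq> I" "q ` C2 \<noteq> {}" using insert.prems N0(1) by (auto simp: C2_def)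
    show "submodule L R (free_on R I)" if "L \<in> q ` C2" for L
    proof -
      obtain N where N: "N \<in> C" "L = q N" using \<open>L \<in> q ` C2\<close> by (auto simp: C2_def)
      show ?thesis unfolding N(2)
      proof (rule F.submoduleI)
        fix x assume x: "x \<in> q N"
        then have xF: "x \<in> carrier (free_on R I)" using sub(1)[OF N(1)] by (auto simp: q_def)
        have "(\<zero>\<^bsub>free_on R I\<^esub> \<ominus>\<^bsub>free_on R I\<^esub> x) k = \<zero>"
          using x k by (subst free_on_minus_index) (auto simp: xF free_on_index q_def a_minus_def)
        then show "\<ominus>\<^bsub>free_on R I\<^esub> x \<in> q N"
          using sub(3)[OF N(1)] x xF by (simp add: q_def a_minus_def)
        fix y assume "y \<in> q N"
        then show "x \<oplus>\<^bsub>free_on R I\<^esub> y \<in> q N"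
          using sub(5)[OF N(1)] x k by (auto simp: q_def free_on_index)
      next
        fix a x assume "a \<in> carrier R" "x \<in> q N"
        then show "a \<odot>\<^bsub>free_on R I\<^esub> x \<in> q N"
          using sub(4)[OF N(1)] k by (auto simp: q_def free_on_index)
      qed (use sub(1)[OF N(1)] zero_in[OF N(1)] k in \<open>auto simp: q_def free_on_index\<close>)
    qed
    show "x i = \<zero>" if "L \<in> q ` C2" "x \<in> L" "i \<in> I - K" for L x i
      using that insert.prems(4)[of _ x i] by (cases "i = k") (auto simp: q_def C2_def)
  qed
  then obtain N where N: "N \<in> C" "p N = p N0"
    and max: "\<And>N'. N' \<in> C \<Longrightarrow> p N' = p N0 \<Longrightarrow> q N \<subseteq> q N' \<Longrightarrow> q N' = q N"
    by (auto simp: C2_def)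
  have "N' = N" if N': "N' \<in> C" and le: "N \<subseteq> N'" for N'
  proof -
    have "p N \<subseteq> p N'" using le by (auto simp: p_def)
    then have p: "p N' = p N0" using N0(2)[OF N'] N(2) by simp
    have q: "q N' = q N" using max[OF N' p] le by (auto simp: q_def)
    have "x \<in> N" if x: "x \<in> N'" for x
    proof -
      have "x k \<in> p N" using p N(2) x by (auto simp: p_def)
      then obtain y where y: "y \<in> N" "x k = y k" by (auto simp: p_def)
      have xy: "x \<in> carrier (free_on R I)" "y \<in> carrier (free_on R I)"
        using sub(1)[OF N'] sub(1)[OF N(1)] x y by auto
      have "(x \<ominus>\<^bsub>free_on R I\<^esub> y) k = \<zero>"
        using idx[OF N(1) y(1)] k y(2) by (simp add: free_on_minus_index[OF xy])
      then have "x \<ominus>\<^bsub>free_on R I\<^esub> y \<in> q N'"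
        using sub(5)[OF N' x sub(3)[OF N']] le y(1) by (auto simp: q_def a_minus_def)
      then have "x \<ominus>\<^bsub>free_on R I\<^esub> y \<in> N" using q by (auto simp: q_def)
      then have "(x \<ominus>\<^bsub>free_on R I\<^esub> y) \<oplus>\<^bsub>free_on R I\<^esub> y \<in> N" using sub(5)[OF N(1)] y(1) by blast
      then show ?thesis using xy by (simp add: F.minus_eq F.a_assoc F.l_neg)
    qed
    then show ?thesis using le by blast
  qed
  then show ?case using N(1) by blast
qed

lemma noetherian_maximal_submodule:
  assumes "noetherian_ring R" "finite I" "C \<noteq> {}"
    and "\<And>N. N \<in> C \<Longrightarrow> submodule N R (free_on R I)"
  shows "\<exists>N\<in>C. \<forall>N'\<in>C. N \<subseteq> N' \<longrightarrow> N' = N"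
  by (rule noetherian_maximal_submodule_aux[OF assms(1,2) order_refl assms(3,4)]) auto

section \<open>Comparing ranks\<close>

text \<open>A homogeneous linear system over the domain \<open>R/P\<close> with fewer equations than unknowns has a nontrivial
  solution, stated with congruences modulo \<open>P\<close>. Only the unknowns in \<open>K\<close> and the equations in \<open>L\<close> count;
  Gaussian elimination removes one of each while the map stays between the same modules.\<close>

lemma elimination:
  assumes P: "primeideal P R" and I: "finite I" and L: "finite L"
    and "L \<subseteq> J" "K \<subseteq> I" "card L < card K" "A \<in> mod_hom R (free_on R I) (free_on R J)"
  shows "\<exists>x\<in>carrier (free_on R I). (\<forall>i\<in>I-K. x i = \<zero>) \<and> (\<exists>i\<in>I. x i \<notin> P) \<and> (\<forall>j\<in>L. A x j \<in> P)"
  using L assms(4-)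
proof (induction L arbitrary: K A rule: finite_induct)
  case empty
  interpret P: primeideal P R by fact
  obtain i where i: "i \<in> K" using empty.prems(3) by (metis card_gt_0_iff card.empty ex_in_conv)
  have "\<one> \<notin> P" using P.one_imp_carrier P.I_notcarr by auto
  then show ?case using i empty.prems(2)
    by (intro bexI[OF _ basis_vec_closed[of I i]]) (auto simp: basis_vec_def)
next
  case (insert j L)
  interpret P: primeideal P R by fact
  interpret F: module R "free_on R I" by (rule free_on_module)
  interpret G: module R "free_on R J" by (rule free_on_module)
  note A = mod_homD[OF insert.prems(4)]
  have j: "j \<in> J" using insert.prems(1) by auto
  have Pz: "\<zero> \<in> P" by (rule P.zero_closed)
  show ?case
  proof (cases "\<exists>i\<in>K. A (basis_vec R I i) j \<notin> P")
    case False
    have "card L < card K" using insert.prems(3) insert.hyps by simp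
    then obtain x where x: "x \<in> carrier (free_on R I)" "\<forall>i\<in>I-K. x i = \<zero>" "\<exists>i\<in>I. x i \<notin> P"
      "\<forall>j\<in>L. A x j \<in> P"
      using insert.IH[of K A] insert.prems by auto
    have "A x j \<in> P"
      using I x(1)
    proof (induction rule: free_on_induct)
      case zero
      show ?case
        using j Pz by (simp add: mod_hom_zero[OF free_on_module free_on_module insert.prems(4)] free_on_index)
    next
      case (add y z)
      then show ?case using j by (simp add: A free_on_index)
    next
      case (basis i)
      show ?case
      proof (cases "i \<in> K")
        case True
        then show ?thesis
          using False basis x(1) j by (simp add: A free_on_index basis_vec_closed P.I_l_closed)
      next
        case False
        then show ?thesis
          using x(2) basis j Pz
          by (simp add: basis_vec_closed free_on_index mod_hom_zero[OF free_on_module free_on_module insert.prems(4)])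
      qed
    qed
    then show ?thesis using x by auto
  next
    case True
    then obtain k where k: "k \<in> K" "A (basis_vec R I k) j \<notin> P" by blast
    have kI: "k \<in> I" using k insert.prems(2) by auto
    define c where "c = A (basis_vec R I k) j"
    have c: "c \<in> carrier R" using A(1)[OF basis_vec_closed] j by (auto simp: c_def free_on_index)
    \<comment> \<open>Solves the \<open>j\<close>-th equation for the \<open>k\<close>-th unknown, with denominators cleared by the pivot \<open>c\<close>.\<close>
    define E where "E = (\<lambda>x. (c \<odot>\<^bsub>free_on R I\<^esub> x) \<ominus>\<^bsub>free_on R I\<^esub> (A x j \<odot>\<^bsub>free_on R I\<^esub> basis_vec R I k))"
    have Aj: "A x j \<in> carrier R" if "x \<in> carrier (free_on R I)" for x
      using A(1)[OF that] j by (auto simp: free_on_index)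
    have E: "E \<in> mod_hom R (free_on R I) (free_on R I)"
    proof (rule mod_homI)
      show "E x \<in> carrier (free_on R I)" if "x \<in> carrier (free_on R I)" for x
        using that c Aj basis_vec_closed[of I k] by (simp add: E_def F.minus_eq)
      fix x y assume xy: "x \<in> carrier (free_on R I)" "y \<in> carrier (free_on R I)"
      show "E (x \<oplus>\<^bsub>free_on R I\<^esub> y) = E x \<oplus>\<^bsub>free_on R I\<^esub> E y"
        using xy c Aj[OF xy(1)] Aj[OF xy(2)] basis_vec_closed[of I k] j
        by (simp add: E_def A free_on_index(2) F.smult_r_distr F.smult_l_distr F.minus_eq F.minus_add F.a_ac)
    next
      fix a x assume ax: "a \<in> carrier R" "x \<in> carrier (free_on R I)"
      show "E (a \<odot>\<^bsub>free_on R I\<^esub> x) = a \<odot>\<^bsub>free_on R I\<^esub> E x"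
        using ax c Aj[OF ax(2)] basis_vec_closed[of I k] j
        by (simp add: E_def A free_on_index(3) F.smult_r_distr F.minus_eq F.smult_r_minus
            m_comm flip: F.smult_assoc1)
    qed
    have "\<exists>x\<in>carrier (free_on R I). (\<forall>i\<in>I-(K-{k}). x i = \<zero>) \<and> (\<exists>i\<in>I. x i \<notin> P)
      \<and> (\<forall>j\<in>L. A (E x) j \<in> P)"
    proof (rule insert.IH)
      show "(\<lambda>x. A (E x)) \<in> mod_hom R (free_on R I) (free_on R J)"
        by (rule mod_hom_comp[OF E insert.prems(4)])
      have "finite K" using I insert.prems(2) finite_subset by blast
      then show "card L < card (K - {k})" using insert.prems(3) insert.hyps k(1) by simp
    qed (use insert.prems in auto)
    then obtain x where x: "x \<in> carrier (free_on R I)" "\<And>i. i \<in> I \<Longrightarrow> i \<notin> K - {k} \<Longrightarrow> x i = \<zero>"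
      and xP: "\<exists>i\<in>I. x i \<notin> P" and xL: "\<forall>j\<in>L. A (E x) j \<in> P" by auto
    have Ei: "E x i = c \<otimes> x i \<ominus> A x j \<otimes> basis_vec R I k i" if "i \<in> I" for i
      unfolding E_def using that x(1) c Aj basis_vec_closed[of I k]
      by (subst free_on_minus_index) (auto simp: free_on_index)
    have "E x i = \<zero>" if "i \<in> I - K" for i
      using that x Ei[of i] k(1) c Aj by (auto simp: basis_vec_def a_minus_def)
    moreover obtain i where i: "i \<in> I" "x i \<notin> P" using xP by blast
    moreover have "E x i \<notin> P"
    proof -
      have "i \<noteq> k" using x(2) i Pz by auto
      then have "E x i = c \<otimes> x i"
        using Ei[OF i(1)] i x(1) c Aj by (simp add: basis_vec_def a_minus_def free_on_index)
      then show ?thesis using P.I_prime[of c "x i"] c i k(2) free_on_index(4)[OF i(1) x(1)] by (auto simp: c_def)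
    qed
    moreover have "A (E x) j \<in> P"
    proof -
      have 1: "c \<odot>\<^bsub>free_on R I\<^esub> x \<in> carrier (free_on R I)"
        "A x j \<odot>\<^bsub>free_on R I\<^esub> basis_vec R I k \<in> carrier (free_on R I)"
        using x(1) c Aj basis_vec_closed[of I k] by auto
      have "A (E x) j = A (c \<odot>\<^bsub>free_on R I\<^esub> x) j \<ominus> A (A x j \<odot>\<^bsub>free_on R I\<^esub> basis_vec R I k) j"
        unfolding E_def mod_hom_minus[OF free_on_module free_on_module insert.prems(4) 1]
        by (rule free_on_minus_index) (use 1 A(1) j in auto)
      also have "\<dots> = c \<otimes> A x j \<ominus> A x j \<otimes> c"
        using x(1) c Aj basis_vec_closed[of I k] j by (simp add: A free_on_index c_def)
      also have "\<dots> = \<zero>" using c Aj[OF x(1)] by (simp add: m_comm a_minus_def r_neg)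
      finally show ?thesis using Pz by simp
    qed
    ultimately show ?thesis
      using xL mod_homD(1)[OF E x(1)] by (intro bexI[of _ "E x"]) auto
  qed
qed

text \<open>After inverting \<open>s\<close>, a surjection \<open>R\<^sup>I \<rightarrow> R\<^sup>J\<close> with \<open>card I \<le> card J\<close> is injective: followed by a coordinate
  projection \<open>R\<^sup>J \<rightarrow> R\<^sup>I\<close> it becomes a surjective endomorphism \<open>T\<close> of a noetherian module, and the kernels of the
  powers of \<open>T\<close> become stationary.\<close>

lemma kernel_torsion_of_surjective_up_to:
  assumes noeth: "noetherian_ring R" and fin: "finite I" "finite J" and card: "card I \<le> card J"
    and A: "A \<in> mod_hom R (free_on R I) (free_on R J)" and s: "s \<in> carrier R"
    and surj: "\<And>y. y \<in> carrier (free_on R J) \<Longrightarrow> \<exists>x\<in>carrier (free_on R I). A x = s \<odot>\<^bsub>free_on R J\<^esub> y"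
  shows "\<exists>n::nat. \<forall>x\<in>mod_kernel (free_on R I) (free_on R J) A. (s [^] n) \<odot>\<^bsub>free_on R I\<^esub> x = \<zero>\<^bsub>free_on R I\<^esub>"
proof -
  interpret F: module R "free_on R I" by (rule free_on_module)
  interpret G: module R "free_on R J" by (rule free_on_module)
  let ?F = "free_on R I"
  obtain \<iota> where \<iota>: "\<iota> ` I \<subseteq> J" "inj_on \<iota> I" using card_le_inj[OF fin card] by blast
  define B where "B = (\<lambda>(y :: _ \<Rightarrow> 'a). \<lambda>i\<in>I. y (\<iota> i))"
  have B: "B \<in> mod_hom R (free_on R J) ?F"
    using \<iota> by (intro mod_homI) (auto simp: B_def free_on_simps intro!: restrict_ext)
  define T where "T = (\<lambda>x. B (A x))"
  have T: "T \<in> mod_hom R ?F ?F" unfolding T_def by (rule mod_hom_comp[OF A B])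
  note A' = mod_homD[OF A] and B' = mod_homD[OF B] and T' = mod_homD[OF T]
  have Tsurj: "\<exists>x\<in>carrier ?F. T x = s \<odot>\<^bsub>?F\<^esub> z" if z: "z \<in> carrier ?F" for z
  proof -
    define y where "y = (\<lambda>j\<in>J. if j \<in> \<iota> ` I then z (the_inv_into I \<iota> j) else \<zero>)"
    have y: "y \<in> carrier (free_on R J)"
      using z \<iota> by (auto simp: y_def free_on_simps the_inv_into_f_f PiE_iff)
    have "B y = z"
      using z \<iota> by (intro free_on_eqI[OF B'(1)[OF y] z]) (auto simp: B_def y_def the_inv_into_f_f)
    then show ?thesis using surj[OF y] B'(3)[OF s y] by (metis T_def)
  qed
  have Tn: "T ^^ n \<in> mod_hom R ?F ?F" for n
  proof (induction n)
    case 0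
    then show ?case by (auto intro: mod_homI)
  next
    case (Suc n)
    then show ?case using mod_hom_comp[OF Suc T] by (simp add: o_def)
  qed
  define C where "C = range (\<lambda>n. mod_kernel ?F ?F (T ^^ n))"
  have "\<exists>N\<in>C. \<forall>N'\<in>C. N \<subseteq> N' \<longrightarrow> N' = N"
  proof (rule noetherian_maximal_submodule[OF noeth fin(1)])
    show "submodule N R ?F" if "N \<in> C" for N
      using that submodule_kernel[OF free_on_module free_on_module Tn] by (auto simp: C_def)
  qed (auto simp: C_def)
  then obtain n where n: "\<And>m. mod_kernel ?F ?F (T ^^ n) \<subseteq> mod_kernel ?F ?F (T ^^ m)
      \<Longrightarrow> mod_kernel ?F ?F (T ^^ m) = mod_kernel ?F ?F (T ^^ n)"
    by (auto simp: C_def)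
  have Tz: "T \<zero>\<^bsub>?F\<^esub> = \<zero>\<^bsub>?F\<^esub>" by (rule mod_hom_zero[OF free_on_module free_on_module T])
  have stab: "mod_kernel ?F ?F (T ^^ Suc n) = mod_kernel ?F ?F (T ^^ n)"
    by (rule n) (auto simp: mod_kernel_def Tz)
  have div: "\<exists>y\<in>carrier ?F. (T ^^ m) y = (s [^] m) \<odot>\<^bsub>?F\<^esub> x" if "x \<in> carrier ?F" for x m
    using that
  proof (induction m arbitrary: x)
    case 0
    then show ?case by auto
  next
    case (Suc m)
    obtain y where y: "y \<in> carrier ?F" "T y = s \<odot>\<^bsub>?F\<^esub> x" using Tsurj Suc.prems by blast
    obtain z where z: "z \<in> carrier ?F" "(T ^^ m) z = (s [^] m) \<odot>\<^bsub>?F\<^esub> y"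
      using Suc.IH y(1) by blast
    have "(T ^^ Suc m) z = (s [^] m) \<odot>\<^bsub>?F\<^esub> (s \<odot>\<^bsub>?F\<^esub> x)" using z y s by (simp add: T')
    also have "\<dots> = (s [^] Suc m) \<odot>\<^bsub>?F\<^esub> x" using s Suc.prems by (simp add: F.smult_assoc1)
    finally show ?case using z(1) by blast
  qed
  have "(s [^] n) \<odot>\<^bsub>?F\<^esub> x = \<zero>\<^bsub>?F\<^esub>" if x: "x \<in> carrier ?F" "A x = \<zero>\<^bsub>free_on R J\<^esub>" for x
  proof -
    have Tx: "T x = \<zero>\<^bsub>?F\<^esub>"
      unfolding T_def x(2) by (rule mod_hom_zero[OF free_on_module free_on_module B])
    obtain y where y: "y \<in> carrier ?F" "(T ^^ n) y = (s [^] n) \<odot>\<^bsub>?F\<^esub> x" using div x(1) by blast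
    have "(T ^^ Suc n) y = \<zero>\<^bsub>?F\<^esub>" using x(1) y s Tx by (simp add: T')
    then have "y \<in> mod_kernel ?F ?F (T ^^ n)" using stab y(1) by (auto simp: mod_kernel_def)
    then show ?thesis using y by (simp add: mod_kernel_def)
  qed
  then show ?thesis by (auto simp: mod_kernel_def)
qed

end

section \<open>Modules of finite length over a local ring\<close>

lemma local_ring_unit:
  fixes R (structure)
  assumes "noetherian_ring R" "local_ring R \<mm>" "a \<in> carrier R" "a \<notin> \<mm>"
  shows "a \<in> Units R"
proof -
  interpret cring R using assms(2) by (simp add: local_ring_def)
  interpret N: noetherian_ring R by fact
  show ?thesis
  proof (rule ccontr)
    assume nu: "a \<notin> Units R"
    define C where "C = {J. ideal J R \<and> a \<in> J \<and> J \<noteq> carrier R}"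
    have "PIdl a \<noteq> carrier R"
    proof
      assume "PIdl a = carrier R"
      then obtain b where "b \<in> carrier R" "\<one> = b \<otimes> a" by (auto simp: cgenideal_def)
      then show False using nu assms(3) m_comm[of a b] by (auto simp: Units_def)
    qed
    then have "C \<noteq> {}"
      using cgenideal_ideal[OF assms(3)] cgenideal_self[OF assms(3)] by (auto simp: C_def)
    then have "\<exists>J\<in>C. \<forall>J'\<in>C. J \<subseteq> J' \<longrightarrow> J' = J"
      by (rule N.noetherian_maximal_ideal) (simp add: C_def)
    then obtain J where J: "J \<in> C" and max: "\<And>J'. J' \<in> C \<Longrightarrow> J \<subseteq> J' \<Longrightarrow> J' = J" by blast
    have "maximalideal J R"
    proof (rule maximalidealI)
      show "J' = J \<or> J' = carrier R" if "ideal J' R" "J \<subseteq> J'" for J'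
        using max[of J'] that J by (auto simp: C_def)
    qed (use J in \<open>auto simp: C_def\<close>)
    then show False using assms J(1) by (auto simp: local_ring_def C_def)
  qed
qed

lemma primeideal_nat_pow:
  assumes "primeideal P R" "a \<in> carrier R" "a [^]\<^bsub>R\<^esub> (n::nat) \<in> P"
  shows "a \<in> P"
proof -
  interpret primeideal P R by fact
  show ?thesis using assms(3)
  proof (induction n)
    case 0
    then show ?case using one_imp_carrier I_notcarr by auto
  next
    case (Suc n)
    then show ?case using I_prime[of "a [^]\<^bsub>R\<^esub> n" a] assms(2) by auto
  qed
qed

lemma (in abelian_group) add_minus_cancel_right:
  assumes "x \<in> carrier G" "y \<in> carrier G" "z \<in> carrier G"
  shows "(x \<oplus> z) \<oplus> \<ominus> (y \<oplus> z) = x \<oplus> \<ominus> y"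
proof -
  have "(x \<oplus> z) \<oplus> (\<ominus> y \<oplus> \<ominus> z) = (x \<oplus> \<ominus> y) \<oplus> (z \<oplus> \<ominus> z)"
    using assms by (simp only: a_ac a_inv_closed a_closed)
  then show ?thesis using assms by (simp add: minus_add r_neg)
qed

context module begin

lemma submoduleI_smult:
  assumes "H \<subseteq> carrier M" "\<zero>\<^bsub>M\<^esub> \<in> H" "\<And>x y. x \<in> H \<Longrightarrow> y \<in> H \<Longrightarrow> x \<oplus>\<^bsub>M\<^esub> y \<in> H"
    and "\<And>a x. a \<in> carrier R \<Longrightarrow> x \<in> H \<Longrightarrow> a \<odot>\<^bsub>M\<^esub> x \<in> H"
  shows "submodule H R M"
proof (rule submoduleI)
  fix x assume "x \<in> H"
  then show "\<ominus>\<^bsub>M\<^esub> x \<in> H" using assms(4)[of "\<ominus> \<one>" x] assms(1) by (auto simp: smult_l_minus)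
qed (use assms in auto)

lemma submodule_zero:
  assumes "submodule N R M"
  shows "\<zero>\<^bsub>M\<^esub> \<in> N"
  using submoduleE(1,2,4)[OF assms] by (metis R.zero_closed all_not_in_conv smult_l_null subsetD)

lemma submodule_of_submodule:
  assumes S: "submodule S R M" and N: "submodule N R (M\<lparr>carrier := S\<rparr>)"
  shows "submodule N R M" "N \<subseteq> S"
proof -
  interpret S: module R "M\<lparr>carrier := S\<rparr>"
    using submodule.submodule_is_module[OF S] module_axioms by blast
  note E = S.submoduleE[OF N]
  show "N \<subseteq> S" using E(1) by simp
  show "submodule N R M"
    using E S.submodule_zero[OF N] submoduleE(1)[OF S] by (intro submoduleI_smult) auto
qed

lemma submodule_add_cyclic:
  assumes N: "submodule N R M" and x: "x \<in> carrier M"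
  shows "submodule {y \<oplus>\<^bsub>M\<^esub> c \<odot>\<^bsub>M\<^esub> x |y c. y \<in> N \<and> c \<in> carrier R} R M" (is "submodule ?H R M")
proof (rule submoduleI_smult)
  note E = submoduleE[OF N]
  show "?H \<subseteq> carrier M" using E(1) x by auto
  show "\<zero>\<^bsub>M\<^esub> \<in> ?H"
    using submodule_zero[OF N] x by (auto intro!: exI[of _ "\<zero>\<^bsub>M\<^esub>"] exI[of _ "\<zero>"])
  fix u v assume "u \<in> ?H" "v \<in> ?H"
  then obtain y c z d where *: "u = y \<oplus>\<^bsub>M\<^esub> c \<odot>\<^bsub>M\<^esub> x" "v = z \<oplus>\<^bsub>M\<^esub> d \<odot>\<^bsub>M\<^esub> x" "y \<in> N" "z \<in> N"
    "c \<in> carrier R" "d \<in> carrier R" by blast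
  then have "u \<oplus>\<^bsub>M\<^esub> v = (y \<oplus>\<^bsub>M\<^esub> z) \<oplus>\<^bsub>M\<^esub> (c \<oplus> d) \<odot>\<^bsub>M\<^esub> x"
    using E(1) x by (auto simp: smult_l_distr M.a_ac subset_iff)
  then show "u \<oplus>\<^bsub>M\<^esub> v \<in> ?H" using * E(5) by blast
next
  note E = submoduleE[OF N]
  fix a u assume a: "a \<in> carrier R" and "u \<in> ?H"
  then obtain y c where *: "u = y \<oplus>\<^bsub>M\<^esub> c \<odot>\<^bsub>M\<^esub> x" "y \<in> N" "c \<in> carrier R" by blast
  then have "a \<odot>\<^bsub>M\<^esub> u = a \<odot>\<^bsub>M\<^esub> y \<oplus>\<^bsub>M\<^esub> (a \<otimes> c) \<odot>\<^bsub>M\<^esub> x"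
    using E(1) x a by (auto simp: smult_r_distr smult_assoc1 subset_iff)
  then show "a \<odot>\<^bsub>M\<^esub> u \<in> ?H" using * E(4) a by blast
qed

text \<open>The submodules generated by \<open>x, a x, a\<^sup>2 x, \<dots>\<close> cannot decrease strictly more often than the length
  permits. So \<open>a\<^sup>j x = c a\<^sup>j\<^sup>+\<^sup>1 x\<close> for some \<open>j\<close> and \<open>c\<close>, and \<open>1 - c a\<close> is a unit.\<close>

lemma finite_length_nilpotent:
  assumes noeth: "noetherian_ring R" and loc: "local_ring R \<mm>" and len: "module_length R M < \<infinity>"
  shows "\<exists>n::nat. \<forall>a\<in>\<mm>. \<forall>x\<in>carrier M. (a [^] n) \<odot>\<^bsub>M\<^esub> x = \<zero>\<^bsub>M\<^esub>"
proof -
  obtain L where L: "module_length R M = enat L" using len by auto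
  have bound: "n \<le> L" if "\<forall>i\<le>n. submodule (N i) R M" "\<forall>i<n. N i \<subset> N (Suc i)" for n N
  proof -
    have "enat n \<le> module_length R M"
      unfolding module_length_def using that by (intro SUP_upper) auto
    then show ?thesis by (simp add: L)
  qed
  interpret m: maximalideal \<mm> R using loc by (simp add: local_ring_def)
  have "(a [^] L) \<odot>\<^bsub>M\<^esub> x = \<zero>\<^bsub>M\<^esub>" if a: "a \<in> \<mm>" and x: "x \<in> carrier M" for a x
  proof -
    have aR: "a \<in> carrier R" using a m.Icarr by blast
    define N where "N = (\<lambda>i. {\<zero>\<^bsub>M\<^esub> \<oplus>\<^bsub>M\<^esub> c \<odot>\<^bsub>M\<^esub> ((a [^] (Suc L - i)) \<odot>\<^bsub>M\<^esub> x) |c. c \<in> carrier R})"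
    have N: "N i = {c \<odot>\<^bsub>M\<^esub> ((a [^] (Suc L - i)) \<odot>\<^bsub>M\<^esub> x) |c. c \<in> carrier R}" for i
      using aR x by (force simp: N_def)
    have zero: "submodule {\<zero>\<^bsub>M\<^esub>} R M" by (rule submoduleI_smult) auto
    have sub: "submodule (N i) R M" for i
      using submodule_add_cyclic[OF zero, of "(a [^] (Suc L - i)) \<odot>\<^bsub>M\<^esub> x"] aR x by (simp add: N_def)
    have "N i \<subseteq> N (Suc i)" if i: "i < Suc L" for i
    proof
      fix y assume "y \<in> N i"
      then obtain c where c: "c \<in> carrier R" "y = c \<odot>\<^bsub>M\<^esub> ((a [^] Suc (L - i)) \<odot>\<^bsub>M\<^esub> x)"
        using i by (auto simp: N Suc_diff_le)
      have "y = (c \<otimes> a) \<odot>\<^bsub>M\<^esub> ((a [^] (L - i)) \<odot>\<^bsub>M\<^esub> x)"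
        using c aR x by (simp add: R.m_ac flip: smult_assoc1)
      then show "y \<in> N (Suc i)" using c aR by (auto simp: N)
    qed
    moreover have "\<not> (\<forall>i<Suc L. N i \<subset> N (Suc i))" using bound[of "Suc L" N] sub not_less_eq_eq by blast
    ultimately obtain i where i: "i < Suc L" "N (Suc i) = N i" by (metis psubsetI)
    define j where "j = L - i"
    define y where "y = (a [^] j) \<odot>\<^bsub>M\<^esub> x"
    have y: "y \<in> carrier M" using aR x by (simp add: y_def)
    have "y \<in> N (Suc i)" unfolding N y_def j_def using aR x by (auto intro!: exI[of _ "\<one>"])
    then have "y \<in> N i" using i(2) by simp
    then obtain c where c: "c \<in> carrier R" "y = c \<odot>\<^bsub>M\<^esub> ((a [^] Suc j) \<odot>\<^bsub>M\<^esub> x)"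
      using i by (auto simp: N j_def Suc_diff_le)
    have "c \<odot>\<^bsub>M\<^esub> ((a [^] Suc j) \<odot>\<^bsub>M\<^esub> x) = (c \<otimes> a) \<odot>\<^bsub>M\<^esub> y"
      using c(1) aR x by (simp add: y_def R.m_ac flip: smult_assoc1)
    with c(2) have cy: "y = (c \<otimes> a) \<odot>\<^bsub>M\<^esub> y" by (rule trans)
    have "\<one> \<ominus> c \<otimes> a \<notin> \<mm>"
    proof
      assume "\<one> \<ominus> c \<otimes> a \<in> \<mm>"
      then have "(\<one> \<ominus> c \<otimes> a) \<oplus> c \<otimes> a \<in> \<mm>" using m.I_l_closed[OF a c(1)] by (rule m.a_closed)
      then have "\<one> \<in> \<mm>" using c(1) aR by (simp add: R.minus_eq R.a_assoc R.l_neg)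
      then show False using m.one_imp_carrier m.I_notcarr by blast
    qed
    then have u: "\<one> \<ominus> c \<otimes> a \<in> Units R" using c(1) aR by (intro local_ring_unit[OF noeth loc]) auto
    have "(\<one> \<ominus> c \<otimes> a) \<odot>\<^bsub>M\<^esub> y = y \<oplus>\<^bsub>M\<^esub> \<ominus>\<^bsub>M\<^esub> ((c \<otimes> a) \<odot>\<^bsub>M\<^esub> y)"
      using c(1) aR y by (simp add: R.minus_eq smult_l_distr smult_l_minus)
    also have "\<dots> = \<zero>\<^bsub>M\<^esub>" using y by (simp flip: cy add: M.r_neg)
    finally have "inv (\<one> \<ominus> c \<otimes> a) \<odot>\<^bsub>M\<^esub> ((\<one> \<ominus> c \<otimes> a) \<odot>\<^bsub>M\<^esub> y) = \<zero>\<^bsub>M\<^esub>" using u by simp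
    then have y0: "y = \<zero>\<^bsub>M\<^esub>" using u y c(1) aR by (simp flip: smult_assoc1)
    have "a [^] L = a [^] i \<otimes> a [^] j" using i(1) aR by (simp add: j_def R.nat_pow_mult)
    then have "(a [^] L) \<odot>\<^bsub>M\<^esub> x = (a [^] i) \<odot>\<^bsub>M\<^esub> y" using aR x by (simp add: y_def smult_assoc1)
    then show ?thesis using y0 aR by simp
  qed
  then show ?thesis by blast
qed

text \<open>Finite length of a submodule, witnessed by a bounded, strictly increasing rank function \<open>\<rho>\<close> on its
  submodules. Such functions are easier to extend than bounds on the length of chains.\<close>

definition length_bounded :: "'c set \<Rightarrow> bool" where
  "length_bounded N \<longleftrightarrow> (\<exists>\<rho> :: 'c set \<Rightarrow> nat. \<exists>n.
    (\<forall>A. submodule A R M \<longrightarrow> A \<subseteq> N \<longrightarrow> \<rho> A \<le> n) \<and>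
    (\<forall>A B. submodule A R M \<longrightarrow> submodule B R M \<longrightarrow> A \<subset> B \<longrightarrow> B \<subseteq> N \<longrightarrow> \<rho> A < \<rho> B))"

lemma length_bounded_imp_module_length:
  assumes S: "submodule S R M" and b: "length_bounded S"
  shows "module_length R (M\<lparr>carrier := S\<rparr>) < \<infinity>"
proof -
  obtain \<rho> :: "'c set \<Rightarrow> nat" and n where \<rho>: "\<And>A. submodule A R M \<Longrightarrow> A \<subseteq> S \<Longrightarrow> \<rho> A \<le> n"
    "\<And>A B. submodule A R M \<Longrightarrow> submodule B R M \<Longrightarrow> A \<subset> B \<Longrightarrow> B \<subseteq> S \<Longrightarrow> \<rho> A < \<rho> B"
    using b unfolding length_bounded_def by blast
  have "k \<le> n" if N: "\<forall>i\<le>k. submodule (N i) R (M\<lparr>carrier := S\<rparr>)" "\<forall>i<k. N i \<subset> N (Suc i)" for k N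
  proof -
    have sub: "submodule (N i) R M" "N i \<subseteq> S" if "i \<le> k" for i
      using submodule_of_submodule[OF S] N(1) that by blast+
    have "i \<le> \<rho> (N i)" if "i \<le> k" for i using that
    proof (induction i)
      case (Suc i)
      then show ?case using \<rho>(2)[of "N i" "N (Suc i)"] sub[of i] sub[of "Suc i"] N(2) by force
    qed auto
    then show ?thesis using \<rho>(1)[OF sub[of k]] by (meson le_trans order_refl)
  qed
  then have "module_length R (M\<lparr>carrier := S\<rparr>) \<le> enat n"
    unfolding module_length_def by (intro SUP_least) auto
  then show ?thesis by (metis enat_ord_simps(4) infinity_ileE not_less)
qed

lemma length_bounded_zero: "length_bounded {\<zero>\<^bsub>M\<^esub>}"
proof -
  have "\<not> A \<subset> B" if "submodule A R M" "B \<subseteq> {\<zero>\<^bsub>M\<^esub>}" for A B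
    using submodule_zero[OF that(1)] that(2) by auto
  then show ?thesis unfolding length_bounded_def by (intro exI[of _ "\<lambda>_. 0"] exI[of _ 0]) auto
qed

text \<open>The quotient by \<open>N\<close> is zero or simple, so the only new information about a submodule is whether it is
  contained in \<open>N\<close>.\<close>

lemma length_bounded_add_cyclic:
  assumes noeth: "noetherian_ring R" and loc: "local_ring R \<mm>"
    and N: "submodule N R M" and b: "length_bounded N"
    and x: "x \<in> carrier M" and mx: "\<And>a. a \<in> \<mm> \<Longrightarrow> a \<odot>\<^bsub>M\<^esub> x \<in> N"
  shows "length_bounded {y \<oplus>\<^bsub>M\<^esub> c \<odot>\<^bsub>M\<^esub> x |y c. y \<in> N \<and> c \<in> carrier R}" (is "length_bounded ?H")
proof -
  obtain \<rho> :: "'c set \<Rightarrow> nat" and n where \<rho>: "\<And>A. submodule A R M \<Longrightarrow> A \<subseteq> N \<Longrightarrow> \<rho> A \<le> n"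
    "\<And>A B. submodule A R M \<Longrightarrow> submodule B R M \<Longrightarrow> A \<subset> B \<Longrightarrow> B \<subseteq> N \<Longrightarrow> \<rho> A < \<rho> B"
    using b unfolding length_bounded_def by blast
  define \<sigma> where "\<sigma> = (\<lambda>A. \<rho> (A \<inter> N) + (if A \<subseteq> N then 0 else 1))"
  note EN = submoduleE[OF N]
  have int: "submodule (A \<inter> N) R M" if A: "submodule A R M" for A
    using submoduleE[OF A] EN submodule_zero[OF A] submodule_zero[OF N]
    by (intro submoduleI_smult) auto
  have "\<sigma> A < \<sigma> B" if A: "submodule A R M" and B: "submodule B R M" and "A \<subset> B" "B \<subseteq> ?H" for A B
  proof (cases "A \<inter> N = B \<inter> N")
    case False
    then have "\<rho> (A \<inter> N) < \<rho> (B \<inter> N)" using \<rho>(2)[OF int[OF A] int[OF B]] \<open>A \<subset> B\<close> by blast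
    then show ?thesis using \<open>A \<subset> B\<close> by (auto simp: \<sigma>_def)
  next
    case True
    note EA = submoduleE[OF A] and EB = submoduleE[OF B]
    have "A \<subseteq> N"
    proof (rule ccontr)
      assume "\<not> A \<subseteq> N"
      then obtain z where z: "z \<in> A" "z \<notin> N" by blast
      then obtain y c where yc: "z = y \<oplus>\<^bsub>M\<^esub> c \<odot>\<^bsub>M\<^esub> x" "y \<in> N" "c \<in> carrier R"
        using \<open>A \<subset> B\<close> \<open>B \<subseteq> ?H\<close> by blast
      \<comment> \<open>Since \<open>c\<close> is a unit, \<open>z\<close> allows any element of \<open>B\<close> to be moved into \<open>N\<close> by subtracting a multiple.\<close>
      have "c \<notin> \<mm>" using yc z(2) EN(5) mx by blast
      then have c: "c \<in> Units R" using yc(3) by (intro local_ring_unit[OF noeth loc])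
      have "B \<subseteq> A"
      proof
        fix w assume w: "w \<in> B"
        then obtain y' d where yd: "w = y' \<oplus>\<^bsub>M\<^esub> d \<odot>\<^bsub>M\<^esub> x" "y' \<in> N" "d \<in> carrier R"
          using \<open>B \<subseteq> ?H\<close> by blast
        define t where "t = d \<otimes> inv c"
        have t: "t \<in> carrier R" "t \<otimes> c = d" using c yd(3) by (auto simp: t_def R.m_assoc R.Units_closed)
        have cM: "y \<in> carrier M" "y' \<in> carrier M" "z \<in> carrier M" "w \<in> carrier M"
          using yc yd EN(1) x by auto
        have tz: "t \<odot>\<^bsub>M\<^esub> z \<in> A" using EA(4) t(1) z(1) .
        have eq: "t \<odot>\<^bsub>M\<^esub> z = t \<odot>\<^bsub>M\<^esub> y \<oplus>\<^bsub>M\<^esub> d \<odot>\<^bsub>M\<^esub> x"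
          using yc t cM x by (simp add: smult_r_distr flip: smult_assoc1)
        have "w \<oplus>\<^bsub>M\<^esub> \<ominus>\<^bsub>M\<^esub> (t \<odot>\<^bsub>M\<^esub> z) = y' \<oplus>\<^bsub>M\<^esub> \<ominus>\<^bsub>M\<^esub> (t \<odot>\<^bsub>M\<^esub> y)"
          unfolding eq yd(1) using cM t(1) yd(3) x
          by (intro M.add_minus_cancel_right) auto
        also have "\<dots> \<in> N" using EN(3,4,5) yc(2) yd(2) t(1) by blast
        finally have "w \<oplus>\<^bsub>M\<^esub> \<ominus>\<^bsub>M\<^esub> (t \<odot>\<^bsub>M\<^esub> z) \<in> B \<inter> N"
          using EB(3,5) w tz \<open>A \<subset> B\<close> by blast
        then have "w \<oplus>\<^bsub>M\<^esub> \<ominus>\<^bsub>M\<^esub> (t \<odot>\<^bsub>M\<^esub> z) \<in> A" using True by blast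
        then have "(w \<oplus>\<^bsub>M\<^esub> \<ominus>\<^bsub>M\<^esub> (t \<odot>\<^bsub>M\<^esub> z)) \<oplus>\<^bsub>M\<^esub> t \<odot>\<^bsub>M\<^esub> z \<in> A" using EA(5) tz by blast
        then show "w \<in> A" using cM t(1) by (simp add: M.a_assoc M.l_neg)
      qed
      then show False using \<open>A \<subset> B\<close> by blast
    qed
    then show ?thesis using True \<open>A \<subset> B\<close> by (auto simp: \<sigma>_def)
  qed
  moreover have "\<sigma> A \<le> n + 1" if "submodule A R M" for A
    using \<rho>(1)[OF int[OF that]] by (simp add: \<sigma>_def)
  ultimately show ?thesis unfolding length_bounded_def by (intro exI[of _ \<sigma>] exI[of _ "n + 1"]) blast
qed

text \<open>Treat the elements of \<open>A\<close> one after the other: multiply by the last power of \<open>a\<close> that does not lead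
  into \<open>N\<close>. The elements treated before still multiply the new vector into \<open>N\<close>.\<close>

lemma exists_killed_modulo:
  assumes "finite A" "A \<subseteq> carrier R" and N: "submodule N R M" and S: "submodule S R M" "\<not> S \<subseteq> N"
    and nil: "\<And>a x. a \<in> A \<Longrightarrow> x \<in> S \<Longrightarrow> \<exists>k::nat. (a [^] k) \<odot>\<^bsub>M\<^esub> x \<in> N"
  shows "\<exists>x\<in>S. x \<notin> N \<and> (\<forall>a\<in>A. a \<odot>\<^bsub>M\<^esub> x \<in> N)"
  using assms(1,2) nil
proof (induction A rule: finite_induct)
  case empty
  then show ?case using S(2) by auto
next
  case (insert a A)
  note EN = submoduleE[OF N] and ES = submoduleE[OF S(1)]
  obtain x where x: "x \<in> S" "x \<notin> N" "\<forall>b\<in>A. b \<odot>\<^bsub>M\<^esub> x \<in> N" using insert by auto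
  have a: "a \<in> carrier R" using insert.prems by auto
  have xM: "x \<in> carrier M" using ES(1) x(1) by blast
  define k where "k = (LEAST k::nat. (a [^] k) \<odot>\<^bsub>M\<^esub> x \<in> N)"
  have k: "(a [^] k) \<odot>\<^bsub>M\<^esub> x \<in> N"
    unfolding k_def using insert.prems(2)[of a x] x(1) by (auto intro: LeastI)
  then have "k \<noteq> 0" using x(2) xM by (cases k) auto
  then obtain j where j: "k = Suc j" using not0_implies_Suc by blast
  define y where "y = (a [^] j) \<odot>\<^bsub>M\<^esub> x"
  have "y \<notin> N" using not_less_Least[of j "\<lambda>k. (a [^] k) \<odot>\<^bsub>M\<^esub> x \<in> N"] j by (simp add: k_def y_def)
  moreover have "y \<in> S" using ES(4) x(1) a by (simp add: y_def)
  moreover have "a \<odot>\<^bsub>M\<^esub> y \<in> N" using k a xM by (simp add: j y_def R.m_comm flip: smult_assoc1)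
  moreover have "b \<odot>\<^bsub>M\<^esub> y \<in> N" if "b \<in> A" for b
  proof -
    have b: "b \<in> carrier R" using that insert.prems by auto
    have "b \<odot>\<^bsub>M\<^esub> y = (a [^] j) \<odot>\<^bsub>M\<^esub> (b \<odot>\<^bsub>M\<^esub> x)"
      using a b xM by (simp add: y_def R.m_comm flip: smult_assoc1)
    then show ?thesis using EN(4) x(3) that a by simp
  qed
  ultimately show ?case by blast
qed

end

text \<open>If a submodule \<open>N\<close> of finite length that is maximal with this property were proper, there would be a
  vector outside \<open>N\<close> with \<open>\<mm> x \<subseteq> N\<close>, and adding \<open>x\<close> to \<open>N\<close> would keep the length finite.\<close>

lemma (in cring) nilpotent_imp_finite_length:
  assumes noeth: "noetherian_ring R" and loc: "local_ring R \<mm>"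
    and I: "finite I" and S: "submodule S R (free_on R I)"
    and nil: "\<And>a x. a \<in> \<mm> \<Longrightarrow> x \<in> S \<Longrightarrow> \<exists>k::nat. (a [^] k) \<odot>\<^bsub>free_on R I\<^esub> x = \<zero>\<^bsub>free_on R I\<^esub>"
  shows "module_length R ((free_on R I)\<lparr>carrier := S\<rparr>) < \<infinity>"
proof -
  interpret F: module R "free_on R I" by (rule free_on_module)
  interpret m: maximalideal \<mm> R using loc by (simp add: local_ring_def)
  obtain A where A: "A \<subseteq> carrier R" "finite A" "\<mm> = Idl A"
    using noetherian_ring.finetely_gen[OF noeth m.is_ideal] by blast
  have Am: "A \<subseteq> \<mm>" using genideal_self[OF A(1)] A(3) by simp
  define C where "C = {N. submodule N R (free_on R I) \<and> N \<subseteq> S \<and> F.length_bounded N}"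
  have "submodule {\<zero>\<^bsub>free_on R I\<^esub>} R (free_on R I)" by (rule F.submoduleI_smult) auto
  then have "{\<zero>\<^bsub>free_on R I\<^esub>} \<in> C"
    using F.length_bounded_zero F.submodule_zero[OF S] by (auto simp: C_def)
  then have "\<exists>N\<in>C. \<forall>N'\<in>C. N \<subseteq> N' \<longrightarrow> N' = N"
    by (intro noetherian_maximal_submodule[OF noeth I]) (auto simp: C_def)
  then obtain N where N: "N \<in> C" and max: "\<And>N'. N' \<in> C \<Longrightarrow> N \<subseteq> N' \<Longrightarrow> N' = N"
    by blast
  have Nsub: "submodule N R (free_on R I)" and Nb: "F.length_bounded N" and NS: "N \<subseteq> S"
    using N by (auto simp: C_def)
  note EN = F.submoduleE[OF Nsub] and ES = F.submoduleE[OF S]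
  have "S \<subseteq> N"
  proof (rule ccontr)
    assume nsub: "\<not> S \<subseteq> N"
    have "\<exists>k::nat. (a [^] k) \<odot>\<^bsub>free_on R I\<^esub> x \<in> N" if "a \<in> A" "x \<in> S" for a x
      using nil[of a x] that Am F.submodule_zero[OF Nsub] by (metis subsetD)
    then obtain x where x: "x \<in> S" "x \<notin> N" "\<forall>a\<in>A. a \<odot>\<^bsub>free_on R I\<^esub> x \<in> N"
      using F.exists_killed_modulo[OF A(2,1) Nsub S nsub] by blast
    have xF: "x \<in> carrier (free_on R I)" using ES(1) x(1) by blast
    have "ideal {a \<in> carrier R. a \<odot>\<^bsub>free_on R I\<^esub> x \<in> N} R"
    proof (rule idealI)
      show "subgroup {a \<in> carrier R. a \<odot>\<^bsub>free_on R I\<^esub> x \<in> N} (add_monoid R)"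
      proof (rule add.subgroupI)
        show "{a \<in> carrier R. a \<odot>\<^bsub>free_on R I\<^esub> x \<in> N} \<noteq> {}"
          using F.submodule_zero[OF Nsub] xF by (auto intro: exI[of _ "\<zero>"])
      qed (use EN(3,5) xF in \<open>auto simp: F.smult_l_distr F.smult_l_minus\<close>)
    next
      fix a c assume a: "a \<in> {a \<in> carrier R. a \<odot>\<^bsub>free_on R I\<^esub> x \<in> N}" and c: "c \<in> carrier R"
      then show "c \<otimes> a \<in> {a \<in> carrier R. a \<odot>\<^bsub>free_on R I\<^esub> x \<in> N}"
        using EN(4) xF by (simp add: F.smult_assoc1)
      moreover have "a \<otimes> c = c \<otimes> a" using a c by (simp add: m_comm)
      ultimately show "a \<otimes> c \<in> {a \<in> carrier R. a \<odot>\<^bsub>free_on R I\<^esub> x \<in> N}" by simp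
    qed (rule ring_axioms)
    then have "\<mm> \<subseteq> {a \<in> carrier R. a \<odot>\<^bsub>free_on R I\<^esub> x \<in> N}"
      unfolding A(3) using x(3) A(1) by (intro genideal_minimal) auto
    then have mx: "a \<odot>\<^bsub>free_on R I\<^esub> x \<in> N" if "a \<in> \<mm>" for a using that by blast
    define H where "H = {y \<oplus>\<^bsub>free_on R I\<^esub> c \<odot>\<^bsub>free_on R I\<^esub> x |y c. y \<in> N \<and> c \<in> carrier R}"
    have "H \<in> C"
      unfolding C_def H_def
      using F.submodule_add_cyclic[OF Nsub xF] F.length_bounded_add_cyclic[OF noeth loc Nsub Nb xF mx]
        ES(4,5) x(1) NS by blast
    moreover have "N \<subseteq> H"
    proof
      fix y assume y: "y \<in> N"
      then have "y = y \<oplus>\<^bsub>free_on R I\<^esub> \<zero> \<odot>\<^bsub>free_on R I\<^esub> x" using EN(1) xF by auto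
      then show "y \<in> H" unfolding H_def using y by blast
    qed
    moreover have "x \<in> H"
    proof -
      have "x = \<zero>\<^bsub>free_on R I\<^esub> \<oplus>\<^bsub>free_on R I\<^esub> \<one> \<odot>\<^bsub>free_on R I\<^esub> x" using xF by simp
      then show ?thesis unfolding H_def using F.submodule_zero[OF Nsub] by blast
    qed
    ultimately show False using max x(2) by blast
  qed
  then show ?thesis using F.length_bounded_imp_module_length[OF S] Nb NS by (simp add: subset_antisym)
qed

section \<open>Support and dimension\<close>

text \<open>All fractions \<open>x / s\<close> vanish as soon as the fractions \<open>x / 1\<close> do.\<close>

lemma not_in_Supp_iff:
  assumes M: "module R M" and P: "P \<in> Spec R"
  shows "P \<notin> Supp R M \<longleftrightarrow> (\<forall>x\<in>carrier M. \<exists>u\<in>carrier R - P. u \<odot>\<^bsub>M\<^esub> x = \<zero>\<^bsub>M\<^esub>)"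
proof -
  interpret M: module R M by fact
  interpret P: primeideal P R using P by (simp add: Spec_def)
  let ?r = "fraction_rel R P M"
  have one: "\<one>\<^bsub>R\<^esub> \<in> carrier R - P" using P.one_imp_carrier P.I_notcarr by auto
  have mult: "u \<otimes>\<^bsub>R\<^esub> v \<in> carrier R - P" if "u \<in> carrier R - P" "v \<in> carrier R - P" for u v
    using that P.I_prime[of u v] by auto
  have zero_class: "((y, t) \<in> ?r `` {(x, s)}) \<longleftrightarrow>
      y \<in> carrier M \<and> t \<in> carrier R - P \<and> (\<exists>u\<in>carrier R - P. u \<odot>\<^bsub>M\<^esub> y = \<zero>\<^bsub>M\<^esub>)"
    if x: "x \<in> carrier M" and s: "s \<in> carrier R - P" and u: "u \<in> carrier R - P" "u \<odot>\<^bsub>M\<^esub> x = \<zero>\<^bsub>M\<^esub>"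
    for x s u y t
  proof
    assume "(y, t) \<in> ?r `` {(x, s)}"
    then obtain v where *: "y \<in> carrier M" "t \<in> carrier R - P" "v \<in> carrier R - P"
      "v \<odot>\<^bsub>M\<^esub> (t \<odot>\<^bsub>M\<^esub> x) = v \<odot>\<^bsub>M\<^esub> (s \<odot>\<^bsub>M\<^esub> y)" by (auto simp: fraction_rel_def)
    have "(u \<otimes>\<^bsub>R\<^esub> (v \<otimes>\<^bsub>R\<^esub> s)) \<odot>\<^bsub>M\<^esub> y = u \<odot>\<^bsub>M\<^esub> (v \<odot>\<^bsub>M\<^esub> (s \<odot>\<^bsub>M\<^esub> y))"
      using * s u by (simp add: M.smult_assoc1)
    also have "\<dots> = (v \<otimes>\<^bsub>R\<^esub> t) \<odot>\<^bsub>M\<^esub> (u \<odot>\<^bsub>M\<^esub> x)"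
      unfolding *(4)[symmetric] using *(1-3) u(1) x by (simp add: M.R.m_ac flip: M.smult_assoc1)
    also have "\<dots> = \<zero>\<^bsub>M\<^esub>" using * u by simp
    finally have "(u \<otimes>\<^bsub>R\<^esub> (v \<otimes>\<^bsub>R\<^esub> s)) \<odot>\<^bsub>M\<^esub> y = \<zero>\<^bsub>M\<^esub>" .
    moreover have "u \<otimes>\<^bsub>R\<^esub> (v \<otimes>\<^bsub>R\<^esub> s) \<in> carrier R - P" using u(1) *(3) s by (intro mult)
    ultimately show "y \<in> carrier M \<and> t \<in> carrier R - P \<and> (\<exists>u\<in>carrier R - P. u \<odot>\<^bsub>M\<^esub> y = \<zero>\<^bsub>M\<^esub>)"
      using *(1,2) by blast
  next
    assume "y \<in> carrier M \<and> t \<in> carrier R - P \<and> (\<exists>u\<in>carrier R - P. u \<odot>\<^bsub>M\<^esub> y = \<zero>\<^bsub>M\<^esub>)"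
    then obtain v where *: "y \<in> carrier M" "t \<in> carrier R - P" "v \<in> carrier R - P" "v \<odot>\<^bsub>M\<^esub> y = \<zero>\<^bsub>M\<^esub>"
      by blast
    have "(u \<otimes>\<^bsub>R\<^esub> v) \<odot>\<^bsub>M\<^esub> (t \<odot>\<^bsub>M\<^esub> x) = (v \<otimes>\<^bsub>R\<^esub> t) \<odot>\<^bsub>M\<^esub> (u \<odot>\<^bsub>M\<^esub> x)"
      using *(1-3) u(1) x by (simp add: M.R.m_ac flip: M.smult_assoc1)
    moreover have "(u \<otimes>\<^bsub>R\<^esub> v) \<odot>\<^bsub>M\<^esub> (s \<odot>\<^bsub>M\<^esub> y) = (u \<otimes>\<^bsub>R\<^esub> s) \<odot>\<^bsub>M\<^esub> (v \<odot>\<^bsub>M\<^esub> y)"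
      using *(1-3) u(1) s by (simp add: M.R.m_ac flip: M.smult_assoc1)
    ultimately have "(u \<otimes>\<^bsub>R\<^esub> v) \<odot>\<^bsub>M\<^esub> (t \<odot>\<^bsub>M\<^esub> x) = (u \<otimes>\<^bsub>R\<^esub> v) \<odot>\<^bsub>M\<^esub> (s \<odot>\<^bsub>M\<^esub> y)"
      using * u s by simp
    then show "(y, t) \<in> ?r `` {(x, s)}"
      using * x s mult[OF u(1) *(3)] by (auto simp: fraction_rel_def)
  qed
  have zero: "\<zero>\<^bsub>localization R P M\<^esub> = ?r `` {(\<zero>\<^bsub>M\<^esub>, \<one>\<^bsub>R\<^esub>)}"
    and carr: "carrier (localization R P M) = (carrier M \<times> (carrier R - P)) // ?r"
    by (simp_all add: localization_def)
  have zz: "\<one>\<^bsub>R\<^esub> \<odot>\<^bsub>M\<^esub> \<zero>\<^bsub>M\<^esub> = \<zero>\<^bsub>M\<^esub>" by simp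
  note z = zero_class[OF M.zero_closed one one zz]
  have "carrier (localization R P M) = {\<zero>\<^bsub>localization R P M\<^esub>} \<longleftrightarrow>
    (\<forall>x\<in>carrier M. \<exists>u\<in>carrier R - P. u \<odot>\<^bsub>M\<^esub> x = \<zero>\<^bsub>M\<^esub>)"
  proof
    assume triv: "carrier (localization R P M) = {\<zero>\<^bsub>localization R P M\<^esub>}"
    show "\<forall>x\<in>carrier M. \<exists>u\<in>carrier R - P. u \<odot>\<^bsub>M\<^esub> x = \<zero>\<^bsub>M\<^esub>"
    proof
      fix x assume x: "x \<in> carrier M"
      have "?r `` {(x, \<one>\<^bsub>R\<^esub>)} \<in> carrier (localization R P M)"
        unfolding carr using x one by (intro quotientI) auto
      then have "?r `` {(x, \<one>\<^bsub>R\<^esub>)} = ?r `` {(\<zero>\<^bsub>M\<^esub>, \<one>\<^bsub>R\<^esub>)}" using triv zero by simp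
      moreover have "(x, \<one>\<^bsub>R\<^esub>) \<in> ?r `` {(x, \<one>\<^bsub>R\<^esub>)}" using x one by (auto simp: fraction_rel_def)
      ultimately have "(x, \<one>\<^bsub>R\<^esub>) \<in> ?r `` {(\<zero>\<^bsub>M\<^esub>, \<one>\<^bsub>R\<^esub>)}" by simp
      then show "\<exists>u\<in>carrier R - P. u \<odot>\<^bsub>M\<^esub> x = \<zero>\<^bsub>M\<^esub>" unfolding z by blast
    qed
  next
    assume tors: "\<forall>x\<in>carrier M. \<exists>u\<in>carrier R - P. u \<odot>\<^bsub>M\<^esub> x = \<zero>\<^bsub>M\<^esub>"
    have "?r `` {(x, s)} = ?r `` {(\<zero>\<^bsub>M\<^esub>, \<one>\<^bsub>R\<^esub>)}" if xs: "x \<in> carrier M" "s \<in> carrier R - P" for x s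
    proof -
      obtain u where u: "u \<in> carrier R - P" "u \<odot>\<^bsub>M\<^esub> x = \<zero>\<^bsub>M\<^esub>" using tors xs(1) by blast
      have "(w \<in> ?r `` {(x, s)}) = (w \<in> ?r `` {(\<zero>\<^bsub>M\<^esub>, \<one>\<^bsub>R\<^esub>)})" for w
        by (cases w) (simp only: zero_class[OF xs u] z)
      then show ?thesis by blast
    qed
    then have "carrier (localization R P M) \<subseteq> {\<zero>\<^bsub>localization R P M\<^esub>}"
      unfolding carr zero by (auto elim!: quotientE)
    moreover have "\<zero>\<^bsub>localization R P M\<^esub> \<in> carrier (localization R P M)"
      unfolding carr zero using one by (intro quotientI) simp
    ultimately show "carrier (localization R P M) = {\<zero>\<^bsub>localization R P M\<^esub>}" by blast
  qed
  then show ?thesis using P by (simp add: Supp_def)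
qed

lemma annihilator_subset_of_Supp:
  assumes "module R M" "P \<in> Supp R M"
  shows "annihilator R M \<subseteq> P"
proof (rule ccontr)
  assume "\<not> annihilator R M \<subseteq> P"
  then obtain u where "u \<in> annihilator R M" "u \<notin> P" by blast
  then show False
    using not_in_Supp_iff[OF assms(1), of P] assms(2) by (auto simp: annihilator_def Supp_def)
qed

lemma ideal_annihilator:
  assumes "module R M"
  shows "ideal (annihilator R M) R"
proof -
  interpret M: module R M by fact
  show ?thesis
  proof (rule idealI)
    show "ring R" by (rule M.R.ring_axioms)
    show "subgroup (annihilator R M) (add_monoid R)"
      by (rule M.R.add.subgroupI) (auto simp: annihilator_def M.smult_l_minus M.smult_l_distr)
    fix a c assume a: "a \<in> annihilator R M" and c: "c \<in> carrier R"
    then show "c \<otimes>\<^bsub>R\<^esub> a \<in> annihilator R M" by (auto simp: annihilator_def M.smult_assoc1)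
    show "a \<otimes>\<^bsub>R\<^esub> c \<in> annihilator R M" using a c by (auto simp: annihilator_def M.smult_assoc1)
  qed
qed

context
  fixes R (structure) and J
  assumes R: "cring R" and J: "ideal J R"
begin

interpretation cring R by (rule R)
interpretation J: ideal J R by (rule J)

definition contraction :: "'a set set \<Rightarrow> 'a set" where
  "contraction Q = {a \<in> carrier R. J +> a \<in> Q}"

lemma Quot_carrier: "x \<in> carrier (R Quot J) \<longleftrightarrow> (\<exists>a\<in>carrier R. x = J +> a)"
  by (auto simp: FactRing_def A_RCOSETS_def')

lemma contraction_prime:
  assumes "Q \<in> Spec (R Quot J)"
  shows "contraction Q \<in> Spec R" "J \<subseteq> contraction Q"
proof -
  have Q: "primeideal Q (R Quot J)" using assms by (simp add: Spec_def)
  show "contraction Q \<in> Spec R"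
    using ring_hom_ring.primeideal_vimage[OF J.rcos_ring_hom_ring R Q]
    by (simp add: Spec_def contraction_def)
  interpret Q: primeideal Q "R Quot J" by (rule Q)
  show "J \<subseteq> contraction Q"
  proof
    fix a assume a: "a \<in> J"
    then have "J +> a = J" by (simp add: J.a_rcos_const)
    then show "a \<in> contraction Q"
      using additive_subgroup.zero_closed[OF ideal.axioms(1)[OF Q.is_ideal]] a
      by (auto simp: contraction_def FactRing_def J.Icarr)
  qed
qed

lemma contraction_strict_mono:
  assumes "Q \<in> Spec (R Quot J)" "Q' \<in> Spec (R Quot J)" "Q \<subset> Q'"
  shows "contraction Q \<subset> contraction Q'"
proof -
  interpret Q': primeideal Q' "R Quot J" using assms(2) by (simp add: Spec_def)
  obtain x where x: "x \<in> Q'" "x \<notin> Q" using assms(3) by blast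
  then obtain a where "a \<in> carrier R" "x = J +> a" using Q'.Icarr[OF x(1)] Quot_carrier by auto
  then show ?thesis using x assms(3) by (auto simp: contraction_def)
qed

lemma coset_mem_image_iff:
  assumes P: "ideal P R" "J \<subseteq> P" and a: "a \<in> carrier R"
  shows "J +> a \<in> (+>) J ` P \<longleftrightarrow> a \<in> P"
proof
  interpret P: ideal P R by (rule P(1))
  assume "J +> a \<in> (+>) J ` P"
  then obtain p where p: "p \<in> P" "J +> a = J +> p" by blast
  then have "a \<ominus> p \<in> J" using quotient_eq_iff_same_a_r_cos[OF J a P.Icarr[OF p(1)]] by simp
  then have "(a \<ominus> p) \<oplus> p \<in> P" using P(2) p(1) by (intro P.a_closed) auto
  then show "a \<in> P" using a P.Icarr[OF p(1)] by (simp add: minus_eq a_assoc l_neg)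
qed blast

lemma image_prime:
  assumes "P \<in> Spec R" "J \<subseteq> P"
  shows "(+>) J ` P \<in> Spec (R Quot J)"
proof -
  interpret P: primeideal P R using assms(1) by (simp add: Spec_def)
  note mem = coset_mem_image_iff[OF P.is_ideal assms(2)]
  have "primeideal ((+>) J ` P) (R Quot J)"
  proof (rule primeidealI)
    show "ideal ((+>) J ` P) (R Quot J)" by (rule ring_ideal_imp_quot_ideal[OF J P.is_ideal])
    show "cring (R Quot J)" by (rule J.quotient_is_cring[OF R])
    have "J +> \<one> \<in> carrier (R Quot J)" using Quot_carrier by blast
    moreover have "J +> \<one> \<notin> (+>) J ` P" using mem P.one_imp_carrier P.I_notcarr by auto
    ultimately show "carrier (R Quot J) \<noteq> (+>) J ` P" by blast
    fix x y assume "x \<in> carrier (R Quot J)" "y \<in> carrier (R Quot J)" and xy: "x \<otimes>\<^bsub>R Quot J\<^esub> y \<in> (+>) J ` P"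
    then obtain a b where ab: "a \<in> carrier R" "b \<in> carrier R" "x = J +> a" "y = J +> b"
      by (auto simp: Quot_carrier)
    have "x \<otimes>\<^bsub>R Quot J\<^esub> y = J +> (a \<otimes> b)"
      using ab by (simp add: FactRing_def J.rcoset_mult_add)
    then have "a \<otimes> b \<in> P" using xy mem[of "a \<otimes> b"] ab by simp
    then show "x \<in> (+>) J ` P \<or> y \<in> (+>) J ` P" using P.I_prime[OF ab(1,2)] ab by blast
  qed
  then show ?thesis by (simp add: Spec_def)
qed

lemma krull_dim_quotient_eq:
  assumes "\<And>P. P \<in> Spec R \<Longrightarrow> J \<subseteq> P"
  shows "krull_dim (R Quot J) = krull_dim R"
proof -
  have "(\<exists>P. (\<forall>i\<le>n. P i \<in> Spec (R Quot J)) \<and> (\<forall>i<n. P i \<subset> P (Suc i))) \<longleftrightarrow>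
    (\<exists>P. (\<forall>i\<le>n. P i \<in> Spec R) \<and> (\<forall>i<n. P i \<subset> P (Suc i)))" for n :: nat
  proof
    assume "\<exists>P. (\<forall>i\<le>n. P i \<in> Spec (R Quot J)) \<and> (\<forall>i<n. P i \<subset> P (Suc i))"
    then obtain P where P: "\<forall>i\<le>n. P i \<in> Spec (R Quot J)" "\<forall>i<n. P i \<subset> P (Suc i)" by blast
    then show "\<exists>P. (\<forall>i\<le>n. P i \<in> Spec R) \<and> (\<forall>i<n. P i \<subset> P (Suc i))"
      by (intro exI[of _ "\<lambda>i. contraction (P i)"])
        (simp add: contraction_prime contraction_strict_mono)
  next
    assume "\<exists>P. (\<forall>i\<le>n. P i \<in> Spec R) \<and> (\<forall>i<n. P i \<subset> P (Suc i))"
    then obtain P where P: "\<forall>i\<le>n. P i \<in> Spec R" "\<forall>i<n. P i \<subset> P (Suc i)" by blast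
    have "(+>) J ` P i \<subset> (+>) J ` P (Suc i)" if i: "i < n" for i
    proof -
      have S: "P i \<in> Spec R" "P (Suc i) \<in> Spec R" using P(1) i by auto
      interpret A: primeideal "P i" R using S by (simp add: Spec_def)
      interpret B: primeideal "P (Suc i)" R using S by (simp add: Spec_def)
      obtain a where a: "a \<in> P (Suc i)" "a \<notin> P i" using P(2) i by blast
      then have "J +> a \<notin> (+>) J ` P i"
        using coset_mem_image_iff[OF A.is_ideal assms[OF S(1)] B.Icarr[OF a(1)]] by simp
      then show ?thesis using P(2) i a(1) by blast
    qed
    then show "\<exists>P. (\<forall>i\<le>n. P i \<in> Spec (R Quot J)) \<and> (\<forall>i<n. P i \<subset> P (Suc i))"
      using P(1) assms by (intro exI[of _ "\<lambda>i. (+>) J ` P i"]) (simp add: image_prime)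
  qed
  then show ?thesis by (simp add: krull_dim_def)
qed

text \<open>Every prime of the quotient contracts to a prime that contains powers of all elements of \<open>\<mm>\<close>, hence
  to \<open>\<mm>\<close> itself. So the quotient has at most one prime.\<close>

lemma krull_dim_quotient_nonpos:
  assumes m: "maximalideal \<mm> R" and pow: "\<And>a. a \<in> \<mm> \<Longrightarrow> \<exists>n::nat. a [^] n \<in> J"
  shows "krull_dim (R Quot J) \<le> 0"
  unfolding krull_dim_def
proof (rule SUP_least, clarify)
  fix n P assume P: "\<forall>i\<le>n. P i \<in> Spec (R Quot J)" "\<forall>i<n. P i \<subset> P (Suc i)"
  interpret m: maximalideal \<mm> R by (rule m)
  have "contraction Q = \<mm>" if Q: "Q \<in> Spec (R Quot J)" for Q
  proof -
    interpret C: primeideal "contraction Q" R using contraction_prime(1)[OF Q] by (simp add: Spec_def)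
    have "a \<in> contraction Q" if a: "a \<in> \<mm>" for a
    proof -
      obtain k :: nat where "a [^] k \<in> J" using pow[OF a] by blast
      then show ?thesis
        using primeideal_nat_pow[OF C.primeideal_axioms m.Icarr[OF a]] contraction_prime(2)[OF Q] by blast
    qed
    then show ?thesis using m.I_maximal[OF C.is_ideal] C.a_subset C.I_notcarr by blast
  qed
  then have "n = 0" using contraction_strict_mono[of "P 0" "P 1"] P by (cases n) auto
  then show "ereal (real n) \<le> 0" by simp
qed

end

section \<open>Null-homotopic multiplications on a complex of free modules\<close>

lemma (in cring) mod_hom_ideal_coordinates:
  assumes I: "finite I" and A: "A \<in> mod_hom R (free_on R I) (free_on R J)" and P: "ideal P R"
    and x: "x \<in> carrier (free_on R I)" "\<And>i. i \<in> I \<Longrightarrow> x i \<in> P" and j: "j \<in> J"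
  shows "A x j \<in> P"
proof -
  interpret P: ideal P R by (rule P)
  note A' = mod_homD[OF A]
  show ?thesis using I x(1)
  proof (induction rule: free_on_induct)
    case zero
    then show ?case
      using j P.zero_closed by (simp add: mod_hom_zero[OF free_on_module free_on_module A] free_on_index)
  next
    case (add y z)
    then show ?case using j by (simp add: A' free_on_index)
  next
    case (basis i)
    have "A (basis_vec R I i) j \<in> carrier R"
      using free_on_index(4)[OF j A'(1)[OF basis_vec_closed]] .
    then show ?case
      using x(2)[OF basis] P.Icarr[OF x(2)[OF basis]] j
      by (simp add: A' basis_vec_closed free_on_index P.I_r_closed)
  qed
qed

definition zero_extension :: "('a, 'r) ring_scheme \<Rightarrow> 'i set \<Rightarrow> 'i set \<Rightarrow> ('i \<Rightarrow> 'a) \<Rightarrow> 'i \<Rightarrow> 'a" where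
  "zero_extension R T I x = (\<lambda>t\<in>T. if t \<in> I then x t else \<zero>\<^bsub>R\<^esub>)"

context cring begin

lemma zero_extension_hom:
  "zero_extension R T I \<in> mod_hom R (free_on R I) (free_on R T)"
  by (rule mod_homI) (auto simp: zero_extension_def free_on_simps intro!: restrict_ext)

lemma restrict_hom:
  assumes "I \<subseteq> T"
  shows "(\<lambda>x. restrict x I) \<in> mod_hom R (free_on R T) (free_on R I)"
  using assms by (intro mod_homI) (auto simp: free_on_simps PiE_iff fun_eq_iff restrict_def extensional_def)

lemma zero_extension_restrict:
  assumes "I \<subseteq> T" "x \<in> carrier (free_on R T)" "\<And>t. t \<in> T - I \<Longrightarrow> x t = \<zero>"
  shows "zero_extension R T I (restrict x I) = x"
  using assms by (intro free_on_eqI) (auto simp: zero_extension_def free_on_simps)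

end

text \<open>A complex \<open>\<cdots> \<rightarrow> F 1 \<rightarrow> F 0\<close> of free modules on which multiplication by \<open>s\<close> is homotopic to zero, and the
  degree \<open>r\<close> in which it is going to be truncated.\<close>

locale null_homotopy = cring R for R (structure) +
  fixes \<beta> :: "nat \<Rightarrow> nat" and f h :: "nat \<Rightarrow> (nat \<Rightarrow> 'a) \<Rightarrow> nat \<Rightarrow> 'a" and s :: 'a and r :: nat
  assumes s: "s \<in> carrier R"
    and f: "\<And>i. f (Suc i) \<in> mod_hom R (free_on R {..<\<beta> (Suc i)}) (free_on R {..<\<beta> i})"
    and h: "\<And>i. h i \<in> mod_hom R (free_on R {..<\<beta> i}) (free_on R {..<\<beta> (Suc i)})"
    and ff: "\<And>i x. x \<in> carrier (free_on R {..<\<beta> (Suc (Suc i))}) \<Longrightarrow>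
      f (Suc i) (f (Suc (Suc i)) x) = \<zero>\<^bsub>free_on R {..<\<beta> i}\<^esub>"
    and fh_0: "\<And>x. x \<in> carrier (free_on R {..<\<beta> 0}) \<Longrightarrow> f 1 (h 0 x) = s \<odot>\<^bsub>free_on R {..<\<beta> 0}\<^esub> x"
    and fh_Suc: "\<And>i x. x \<in> carrier (free_on R {..<\<beta> (Suc i)}) \<Longrightarrow>
      f (Suc (Suc i)) (h (Suc i) x) \<oplus>\<^bsub>free_on R {..<\<beta> (Suc i)}\<^esub> h i (f (Suc i) x)
        = s \<odot>\<^bsub>free_on R {..<\<beta> (Suc i)}\<^esub> x"
begin

abbreviation F :: "nat \<Rightarrow> ('a, nat \<Rightarrow> 'a) module" where
  "F i \<equiv> free_on R {..<\<beta> i}"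

definition total :: "(nat \<times> nat) set" where
  "total = {(i, j). i \<le> r \<and> j < \<beta> i}"

text \<open>Indices for a basis of \<open>E\<close> (for \<open>True\<close>) and of \<open>O\<close> (for \<open>False\<close>).\<close>

definition parity :: "bool \<Rightarrow> (nat \<times> nat) set" where
  "parity b = {(i, j). i \<le> r \<and> j < \<beta> i \<and> even (i + r) = b}"

abbreviation G :: "('a, nat \<times> nat \<Rightarrow> 'a) module" where
  "G \<equiv> free_on R total"

definition part :: "nat \<Rightarrow> (nat \<times> nat \<Rightarrow> 'a) \<Rightarrow> nat \<Rightarrow> 'a" where
  "part i x = (\<lambda>j\<in>{..<\<beta> i}. x (i, j))"

text \<open>The contributions of \<open>f\<close> and of \<open>h\<close> to the component of \<open>D x\<close> in degree \<open>i\<close>. Nothing arrives in degree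
  \<open>r\<close> through \<open>f\<close>, or in degree 0 through \<open>h\<close>.\<close>

definition fpart :: "nat \<Rightarrow> (nat \<times> nat \<Rightarrow> 'a) \<Rightarrow> nat \<Rightarrow> 'a" where
  "fpart i x = (if i < r then f (Suc i) (part (Suc i) x) else \<zero>\<^bsub>F i\<^esub>)"

definition hpart :: "nat \<Rightarrow> (nat \<times> nat \<Rightarrow> 'a) \<Rightarrow> nat \<Rightarrow> 'a" where
  "hpart i x = (if i = 0 then \<zero>\<^bsub>F i\<^esub> else h (i - 1) (part (i - 1) x))"

definition D :: "(nat \<times> nat \<Rightarrow> 'a) \<Rightarrow> nat \<times> nat \<Rightarrow> 'a" where
  "D x = (\<lambda>(i, j)\<in>total. (fpart i x \<oplus>\<^bsub>F i\<^esub> hpart i x) j)"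

text \<open>The component of \<open>h\<^sup>2 x\<close> in degree \<open>i\<close>.\<close>

definition hh :: "nat \<Rightarrow> (nat \<times> nat \<Rightarrow> 'a) \<Rightarrow> nat \<Rightarrow> 'a" where
  "hh i x = (if i < 2 then \<zero>\<^bsub>F i\<^esub> else h (i - 1) (h (i - 2) (part (i - 2) x)))"

text \<open>The composite \<open>h f\<close> on \<open>F r\<close>. It differs from multiplication by \<open>s\<close> by a map into the image of
  \<open>f (Suc r)\<close>.\<close>

definition hf :: "(nat \<Rightarrow> 'a) \<Rightarrow> nat \<Rightarrow> 'a" where
  "hf x = (if r = 0 then \<zero>\<^bsub>F r\<^esub> else h (r - 1) (f r x))"

lemma hf_0: "r = 0 \<Longrightarrow> hf x = \<zero>\<^bsub>F r\<^esub>"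
  and hf_Suc: "r = Suc k \<Longrightarrow> hf x = h k (f (Suc k) x)"
  unfolding hf_def by simp_all

sublocale F: module R "F i" for i by (rule free_on_module)
sublocale G: module R G by (rule free_on_module)

lemmas f' = mod_homD[OF f] and h' = mod_homD[OF h]

lemma f_zero: "f (Suc i) \<zero>\<^bsub>F (Suc i)\<^esub> = \<zero>\<^bsub>F i\<^esub>" and h_zero: "h i \<zero>\<^bsub>F i\<^esub> = \<zero>\<^bsub>F (Suc i)\<^esub>"
  by (rule mod_hom_zero[OF free_on_module free_on_module f] mod_hom_zero[OF free_on_module free_on_module h])+

lemma finite_total: "finite total" and finite_parity: "finite (parity b)" and parity_subset: "parity b \<subseteq> total"
proof -
  have "total = Sigma {..r} (\<lambda>i. {..<\<beta> i})" by (auto simp: total_def)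
  then show "finite total" by simp
  show sub: "parity b \<subseteq> total" by (auto simp: parity_def total_def)
  then show "finite (parity b)" using \<open>finite total\<close> by (rule finite_subset)
qed

lemma part_hom: "i \<le> r \<Longrightarrow> part i \<in> mod_hom R G (F i)"
  by (rule mod_homI) (auto simp: part_def free_on_simps total_def intro!: restrict_ext)

lemmas part' = mod_homD[OF part_hom]

lemma part_zero: "i \<le> r \<Longrightarrow> part i \<zero>\<^bsub>G\<^esub> = \<zero>\<^bsub>F i\<^esub>"
  by (rule mod_hom_zero[OF free_on_module free_on_module part_hom])

lemma part_eqI:
  assumes "x \<in> carrier G" "y \<in> carrier G" "\<And>i. i \<le> r \<Longrightarrow> part i x = part i y"
  shows "x = y"
proof (rule free_on_eqI[OF assms(1,2)])
  fix t assume "t \<in> total"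
  then obtain i j where t: "t = (i, j)" "i \<le> r" "j < \<beta> i" by (auto simp: total_def)
  have "part i x j = part i y j" using assms(3)[OF t(2)] by simp
  then show "x t = y t" using t by (simp add: part_def)
qed

lemma fpart_hom: "i \<le> r \<Longrightarrow> fpart i \<in> mod_hom R G (F i)"
  by (rule mod_homI) (auto simp: fpart_def part' f')

lemma hpart_hom: "i \<le> r \<Longrightarrow> hpart i \<in> mod_hom R G (F i)"
proof (cases i)
  case 0
  then show ?thesis by (intro mod_homI) (auto simp: hpart_def)
next
  case (Suc k)
  assume "i \<le> r"
  then have "k \<le> r" using Suc by simp
  then show ?thesis unfolding Suc by (intro mod_homI) (auto simp: hpart_def part' h')
qed

lemmas fpart' = mod_homD[OF fpart_hom] and hpart' = mod_homD[OF hpart_hom]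

lemma D_index: "i \<le> r \<Longrightarrow> j < \<beta> i \<Longrightarrow> D x (i, j) = fpart i x j \<oplus> hpart i x j"
  by (simp add: D_def total_def free_on_index)

lemma D_hom: "D \<in> mod_hom R G G"
proof (rule mod_homI)
  show closed: "D x \<in> carrier G" if "x \<in> carrier G" for x
    using free_on_index(4)[OF _ fpart'(1)[OF _ that]] free_on_index(4)[OF _ hpart'(1)[OF _ that]]
    by (auto simp: D_def free_on_simps total_def)
  note idx = free_on_index(4)[OF _ fpart'(1)] free_on_index(4)[OF _ hpart'(1)]
  show "D (x \<oplus>\<^bsub>G\<^esub> y) = D x \<oplus>\<^bsub>G\<^esub> D y" if xy: "x \<in> carrier G" "y \<in> carrier G" for x y
  proof (rule free_on_eqI[of _ R total])
    fix t assume t: "t \<in> total"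
    then obtain i j where ij: "t = (i, j)" "i \<le> r" "j < \<beta> i" by (auto simp: total_def)
    then show "D (x \<oplus>\<^bsub>G\<^esub> y) t = (D x \<oplus>\<^bsub>G\<^esub> D y) t"
      using t xy idx[of j i] by (simp add: D_index free_on_index(2) fpart' hpart' a_ac)
  qed (use closed xy in auto)
  show "D (a \<odot>\<^bsub>G\<^esub> x) = a \<odot>\<^bsub>G\<^esub> D x" if ax: "a \<in> carrier R" "x \<in> carrier G" for a x
  proof (rule free_on_eqI[of _ R total])
    fix t assume t: "t \<in> total"
    then obtain i j where ij: "t = (i, j)" "i \<le> r" "j < \<beta> i" by (auto simp: total_def)
    then show "D (a \<odot>\<^bsub>G\<^esub> x) t = (a \<odot>\<^bsub>G\<^esub> D x) t"
      using t ax idx[of j i] by (simp add: D_index free_on_index(3) fpart' hpart' r_distr)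
  qed (use closed ax in auto)
qed

lemmas D' = mod_homD[OF D_hom]

lemma part_D:
  assumes "x \<in> carrier G" "i \<le> r"
  shows "part i (D x) = fpart i x \<oplus>\<^bsub>F i\<^esub> hpart i x"
proof (rule free_on_eqI[of _ R "{..<\<beta> i}"])
  show "part i (D x) \<in> carrier (F i)" using assms D' part' by simp
  show "fpart i x \<oplus>\<^bsub>F i\<^esub> hpart i x \<in> carrier (F i)" using assms fpart' hpart' by simp
qed (use assms(2) in \<open>simp add: part_def D_def total_def\<close>)

lemma hh_closed:
  assumes "x \<in> carrier G" "i \<le> r"
  shows "hh i x \<in> carrier (F i)"
proof (cases "i < 2")
  case False
  then obtain k where k: "i = Suc (Suc k)" by (metis Suc_1 add_2_eq_Suc not_less nat_le_iff_add)
  then have "part k x \<in> carrier (F k)" using part'(1) assms by simp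
  then show ?thesis using k by (simp add: hh_def h')
qed (simp add: hh_def)

lemma hpart_D:
  assumes x: "x \<in> carrier G" and i: "Suc i \<le> r"
  shows "hpart (Suc i) (D x) = h i (f (Suc i) (part (Suc i) x)) \<oplus>\<^bsub>F (Suc i)\<^esub> hh (Suc i) x"
proof -
  have c: "part (Suc i) x \<in> carrier (F (Suc i))" using part'(1) x i by blast
  have "hpart (Suc i) (D x) = h i (f (Suc i) (part (Suc i) x) \<oplus>\<^bsub>F i\<^esub> hpart i x)"
    using part_D[OF x, of i] i by (simp add: hpart_def[of "Suc i"] fpart_def)
  also have "\<dots> = h i (f (Suc i) (part (Suc i) x)) \<oplus>\<^bsub>F (Suc i)\<^esub> h i (hpart i x)"
    using c hpart'(1)[of i x] x i by (simp add: f' h')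
  also have "h i (hpart i x) = hh (Suc i) x"
    by (cases i) (simp_all add: hpart_def hh_def h_zero)
  finally show ?thesis .
qed

lemma fpart_D:
  assumes x: "x \<in> carrier G" and i: "i < r"
  shows "fpart i (D x) = f (Suc i) (h i (part i x))"
proof -
  have c: "part i x \<in> carrier (F i)" using part'(1) x i by simp
  have "f (Suc i) (fpart (Suc i) x) = \<zero>\<^bsub>F i\<^esub>"
    using x part'(1)[of "Suc (Suc i)" x] by (auto simp: fpart_def ff f_zero)
  moreover have "hpart (Suc i) x = h i (part i x)" by (simp add: hpart_def)
  moreover have "fpart (Suc i) x \<in> carrier (F (Suc i))" using fpart'(1)[of "Suc i" x] x i by simp
  ultimately show ?thesis
    using part_D[OF x, of "Suc i"] c i by (simp add: fpart_def[of i] f' h')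
qed

lemma part_D_D:
  assumes x: "x \<in> carrier G" and i: "i < r"
  shows "part i (D (D x)) = s \<odot>\<^bsub>F i\<^esub> part i x \<oplus>\<^bsub>F i\<^esub> hh i x"
proof (cases i)
  case 0
  have "part 0 x \<in> carrier (F 0)" using part'(1) x by simp
  then show ?thesis
    using part_D[OF D'(1)[OF x], of i] fpart_D[OF x i] fh_0 s i 0 by (simp add: hpart_def hh_def)
next
  case (Suc k)
  have c: "part (Suc k) x \<in> carrier (F (Suc k))" using part'(1) x i Suc by simp
  have "part i (D (D x)) = f (Suc i) (h i (part i x)) \<oplus>\<^bsub>F i\<^esub>
      (h k (f (Suc k) (part (Suc k) x)) \<oplus>\<^bsub>F (Suc k)\<^esub> hh (Suc k) x)"
    using part_D[OF D'(1)[OF x], of i] fpart_D[OF x i] hpart_D[OF x, of k] i Suc by simp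
  also have "\<dots> = (f (Suc i) (h i (part i x)) \<oplus>\<^bsub>F i\<^esub>
      h k (f (Suc k) (part (Suc k) x))) \<oplus>\<^bsub>F (Suc k)\<^esub> hh (Suc k) x"
    using c hh_closed[OF x, of "Suc k"] i Suc by (simp add: F.a_assoc f' h')
  also have "\<dots> = s \<odot>\<^bsub>F i\<^esub> part i x \<oplus>\<^bsub>F i\<^esub> hh i x"
    using fh_Suc[OF c] Suc by simp
  finally show ?thesis .
qed

lemma part_D_D_top:
  assumes x: "x \<in> carrier G"
  shows "part r (D (D x)) = hf (part r x) \<oplus>\<^bsub>F r\<^esub> hh r x"
proof -
  have c: "part r x \<in> carrier (F r)" using part'(1) x by simp
  have d: "fpart r (D x) = \<zero>\<^bsub>F r\<^esub>" by (simp add: fpart_def)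
  show ?thesis
  proof (cases r)
    case 0
    then have "hpart r (D x) = \<zero>\<^bsub>F r\<^esub>" "hf (part r x) = \<zero>\<^bsub>F r\<^esub>" "hh r x = \<zero>\<^bsub>F r\<^esub>"
      unfolding hpart_def hf_def hh_def by simp_all
    then show ?thesis using part_D[OF D'(1)[OF x] order_refl] d by simp
  next
    case (Suc k)
    then have "hf (part r x) = h k (f (Suc k) (part (Suc k) x))" using hf_Suc[OF Suc] by simp
    then have "hpart r (D x) = hf (part r x) \<oplus>\<^bsub>F r\<^esub> hh r x"
      using hpart_D[OF x, of k] Suc by simp
    then show ?thesis
      using part_D[OF D'(1)[OF x] order_refl] d hpart'(1)[OF order_refl D'(1)[OF x]] by simp
  qed
qed

lemma D_parity:
  assumes x: "x \<in> carrier G" "\<And>t. t \<in> total - parity b \<Longrightarrow> x t = \<zero>" and t: "t \<in> total - parity (\<not> b)"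
  shows "D x t = \<zero>"
proof -
  obtain i j where ij: "t = (i, j)" "i \<le> r" "j < \<beta> i" "even (i + r) = b"
    using t by (auto simp: total_def parity_def)
  have z: "part k x = \<zero>\<^bsub>F k\<^esub>" if "k \<le> r" "even (k + r) \<noteq> b" for k
  proof (rule free_on_eqI[of _ R "{..<\<beta> k}"])
    show "part k x \<in> carrier (F k)" using part'(1) x(1) that(1) by simp
    show "part k x l = \<zero>\<^bsub>F k\<^esub> l" if "l \<in> {..<\<beta> k}" for l
      using x(2)[of "(k, l)"] that \<open>k \<le> r\<close> \<open>even (k + r) \<noteq> b\<close>
      by (auto simp: part_def free_on_index total_def parity_def)
  qed simp
  have "fpart i x = \<zero>\<^bsub>F i\<^esub>" using z[of "Suc i"] ij by (auto simp: fpart_def f_zero)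
  moreover have "hpart i x = \<zero>\<^bsub>F i\<^esub>" using z[of "i - 1"] ij h_zero[of "i - 1"] by (cases i) (auto simp: hpart_def)
  ultimately show ?thesis using ij by (simp add: D_def total_def free_on_index)
qed

lemma part_eq_zero:
  assumes "x \<in> carrier G" "i \<le> r" "\<And>j. j < \<beta> i \<Longrightarrow> x (i, j) = \<zero>"
  shows "part i x = \<zero>\<^bsub>F i\<^esub>"
  using part'(1)[OF assms(2,1)] assms(3)
  by (intro free_on_eqI[of _ R "{..<\<beta> i}"]) (auto simp: part_def free_on_index)

lemma hf_zero: "hf \<zero>\<^bsub>F r\<^esub> = \<zero>\<^bsub>F r\<^esub>"
proof (cases r)
  case (Suc k)
  then have "hf \<zero>\<^bsub>F r\<^esub> = h k (f (Suc k) \<zero>\<^bsub>F (Suc k)\<^esub>)" using hf_Suc[OF Suc] by simp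
  also have "\<dots> = \<zero>\<^bsub>F r\<^esub>" using Suc by (simp only: f_zero h_zero)
  finally show ?thesis .
qed (rule hf_0)

text \<open>The hypothesis \<open>zero\<close> says that the error term of \<open>D\<^sup>2\<close> in degree \<open>r\<close> is killed by some \<open>u\<close> outside
  \<open>P\<close>. If there were more unknowns than equations, some \<open>x\<close> in \<open>E\<close>, nonzero modulo \<open>P\<close>, would have \<open>D x\<close>
  and hence \<open>D (D x)\<close> zero modulo \<open>P\<close>. But \<open>u D\<^sup>2\<close> is triangular with \<open>u s\<close> on the diagonal, so the
  components of \<open>x\<close> vanish modulo \<open>P\<close> in increasing order of degree.\<close>

lemma card_parity_le:
  assumes P: "primeideal P R" and "s \<notin> P" and u: "u \<in> carrier R" "u \<notin> P"
    and zero: "\<And>x. x \<in> carrier (F r) \<Longrightarrow> u \<odot>\<^bsub>F r\<^esub> hf x = u \<odot>\<^bsub>F r\<^esub> (s \<odot>\<^bsub>F r\<^esub> x)"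
  shows "card (parity True) \<le> card (parity False)"
proof (rule ccontr)
  interpret P: primeideal P R by fact
  assume "\<not> ?thesis"
  then have less: "card (parity False) < card (parity True)" by simp
  define A where "A = (\<lambda>x. restrict (D (zero_extension R total (parity True) x)) (parity False))"
  have "A \<in> mod_hom R (free_on R (parity True)) (free_on R (parity False))"
    unfolding A_def by (intro mod_hom_comp[OF mod_hom_comp[OF zero_extension_hom D_hom]]
        restrict_hom parity_subset)
  then obtain z where z: "z \<in> carrier (free_on R (parity True))" "\<exists>t\<in>parity True. z t \<notin> P"
    "\<And>t. t \<in> parity False \<Longrightarrow> A z t \<in> P"
    using elimination[OF P finite_parity finite_parity order_refl order_refl less] by blast
  define x where "x = zero_extension R total (parity True) z"
  have x: "x \<in> carrier G" unfolding x_def using mod_homD(1)[OF zero_extension_hom z(1)] .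
  have Pz: "\<zero> \<in> P" using additive_subgroup.zero_closed[OF ideal.axioms(1)[OF P.is_ideal]] .
  have "D x t \<in> P" if "t \<in> total" for t
  proof (cases "t \<in> parity False")
    case True
    then show ?thesis using z(3)[OF True] by (simp add: A_def x_def)
  next
    case False
    have "D x t = \<zero>"
    proof (rule D_parity[OF x, of True])
      show "x t' = \<zero>" if "t' \<in> total - parity True" for t'
        using that by (simp add: x_def zero_extension_def)
    qed (use False that in simp)
    then show ?thesis using Pz by simp
  qed
  then have DD: "D (D x) t \<in> P" if "t \<in> total" for t
    using mod_hom_ideal_coordinates[OF finite_total D_hom P.is_ideal D'(1)[OF x] _ that] by blast
  have parts: "\<forall>j<\<beta> i. part i x j \<in> P" if "i \<le> r" for i
    using that
  proof (induction i rule: less_induct)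
    case (less i)
    have c: "part i x \<in> carrier (F i)" using part'(1) x less.prems by blast
    have hhP: "hh i x j \<in> P" if j: "j < \<beta> i" for j
    proof (cases "i < 2")
      case False
      then obtain k where k: "i = Suc (Suc k)" by (metis Suc_1 add_2_eq_Suc not_less nat_le_iff_add)
      have pk: "part k x \<in> carrier (F k)" using part'(1) x less.prems k by simp
      have "h k (part k x) l \<in> P" if "l < \<beta> (Suc k)" for l
        by (rule mod_hom_ideal_coordinates[OF _ h P.is_ideal pk]) (use less that k in auto)
      then have "h (Suc k) (h k (part k x)) j \<in> P"
        by (intro mod_hom_ideal_coordinates[OF _ h P.is_ideal h'(1)[OF pk]]) (use j k in auto)
      then show ?thesis using k by (simp add: hh_def)
    qed (use Pz that in \<open>simp add: hh_def free_on_index\<close>)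
    have "u \<odot>\<^bsub>F i\<^esub> part i (D (D x)) = u \<odot>\<^bsub>F i\<^esub> (s \<odot>\<^bsub>F i\<^esub> part i x) \<oplus>\<^bsub>F i\<^esub> u \<odot>\<^bsub>F i\<^esub> hh i x"
    proof (cases "i = r")
      case True
      have "hf (part r x) \<in> carrier (F r)"
      proof (cases r)
        case (Suc k)
        have "part r x \<in> carrier (F r)" using c True by simp
        then have "h k (f (Suc k) (part r x)) \<in> carrier (F r)" using Suc f'(1)[of "part r x" k] h'(1) by simp
        then show ?thesis unfolding hf_Suc[OF Suc] .
      next
        case 0
        show ?thesis unfolding hf_0[OF 0] by simp
      qed
      then show ?thesis
        using part_D_D_top[OF x] True u(1) c hh_closed[OF x less.prems] zero[of "part r x"]
        by (simp add: F.smult_r_distr)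
    next
      case False
      then show ?thesis
        using part_D_D[OF x, of i] less.prems u(1) c hh_closed[OF x less.prems] s
        by (simp add: F.smult_r_distr)
    qed
    then have eq: "u \<otimes> part i (D (D x)) j = u \<otimes> (s \<otimes> part i x j) \<oplus> u \<otimes> hh i x j" if "j < \<beta> i" for j
      using that free_on_index(2,3)[of j "{..<\<beta> i}"] by (metis lessThan_iff)
    show ?case
    proof (intro allI impI)
      fix j assume j: "j < \<beta> i"
      have cj: "part i x j \<in> carrier R" using free_on_index(4)[OF _ c] j by simp
      have "u \<otimes> part i (D (D x)) j \<in> P"
        using DD[of "(i, j)"] j less.prems u(1) by (auto simp: part_def total_def intro!: P.I_l_closed)
      moreover have "u \<otimes> hh i x j \<in> P" using hhP[OF j] u(1) by (rule P.I_l_closed)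
      ultimately have "u \<otimes> part i (D (D x)) j \<ominus> u \<otimes> hh i x j \<in> P"
        by (simp add: minus_eq)
      then have "u \<otimes> (s \<otimes> part i x j) \<in> P"
        using eq[OF j] cj u(1) s P.Icarr[OF hhP[OF j]] by (simp add: minus_eq a_assoc r_neg)
      then show "part i x j \<in> P"
        using P.I_prime[of u "s \<otimes> part i x j"] P.I_prime[of s "part i x j"] cj u s assms(2) by auto
    qed
  qed
  obtain t where t: "t \<in> parity True" "z t \<notin> P" using z(2) by blast
  obtain i j where ij: "t = (i, j)" by (cases t)
  then have "i \<le> r" "j < \<beta> i" using t by (auto simp: parity_def)
  then have "part i x j \<in> P" using parts by blast
  then show False
    using t \<open>j < \<beta> i\<close> parity_subset[of True] by (auto simp: part_def x_def zero_extension_def ij)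
qed

text \<open>Downward induction on the lowest degree of \<open>y\<close>: the correction \<open>D\<^sup>2 y - s y = h\<^sup>2 y\<close> lives in higher
  degrees. The error term in degree \<open>r\<close> does not enter, because \<open>r\<close> is not among the degrees of \<open>O\<close>.\<close>

lemma D_surjective_up_to:
  assumes "y \<in> carrier G" "\<And>t. t \<in> total - parity False \<Longrightarrow> y t = \<zero>"
    and "\<And>i j. (i, j) \<in> total \<Longrightarrow> i + c \<le> r \<Longrightarrow> y (i, j) = \<zero>"
  shows "\<exists>x\<in>carrier G. (\<forall>t\<in>total - parity True. x t = \<zero>) \<and> D x = (s [^] c) \<odot>\<^bsub>G\<^esub> y"
  using assms
proof (induction c arbitrary: y)
  case 0
  have "y = \<zero>\<^bsub>G\<^esub>"
  proof (rule free_on_eqI[of _ R total])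
    show "y t = \<zero>\<^bsub>G\<^esub> t" if "t \<in> total" for t
      using 0(3)[of "fst t" "snd t"] that by (auto simp: free_on_index total_def)
  qed (use 0 in auto)
  then show ?case
    by (intro bexI[of _ "\<zero>\<^bsub>G\<^esub>"])
      (auto simp: mod_hom_zero[OF free_on_module free_on_module D_hom] free_on_index)
next
  case (Suc c)
  note y = Suc.prems
  have Dy: "D y \<in> carrier G" "D (D y) \<in> carrier G" using D' y(1) by auto
  define z where "z = D (D y) \<ominus>\<^bsub>G\<^esub> s \<odot>\<^bsub>G\<^esub> y"
  have z: "z \<in> carrier G" using Dy y(1) s by (simp add: z_def G.minus_eq)
  have Dy0: "D y t = \<zero>" if "t \<in> total - parity True" for t
    using D_parity[OF y(1), of False] y(2) that by simp
  have "D (D y) t = \<zero>" if "t \<in> total - parity False" for t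
    using D_parity[OF Dy(1), of True] Dy0 that by simp
  then have z0: "z t = \<zero>" if "t \<in> total - parity False" for t
    using that y(1,2) Dy s by (simp add: z_def free_on_minus_index free_on_index minus_eq)
  have "z (i, j) = \<zero>" if ij: "(i, j) \<in> total" "i + c \<le> r" for i j
  proof -
    have i: "i \<le> r" and j: "j < \<beta> i" using ij by (auto simp: total_def)
    have c: "part i y \<in> carrier (F i)" using part'(1) y(1) i by blast
    have hh: "hh i y = \<zero>\<^bsub>F i\<^esub>"
    proof (cases "i < 2")
      case False
      then obtain k where k: "i = Suc (Suc k)" by (metis Suc_1 add_2_eq_Suc not_less nat_le_iff_add)
      then have "part k y = \<zero>\<^bsub>F k\<^esub>"
        using ij y(1,3) by (intro part_eq_zero) (auto simp: total_def)
      then show ?thesis using k by (simp add: hh_def h_zero)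
    qed (simp add: hh_def)
    have "part i (D (D y)) = s \<odot>\<^bsub>F i\<^esub> part i y"
    proof (cases "i = r")
      case True
      have "part r y = \<zero>\<^bsub>F r\<^esub>"
        using y(1,2) by (intro part_eq_zero) (auto simp: total_def parity_def)
      then show ?thesis using part_D_D_top[OF y(1)] hh True s by (simp add: hf_zero)
    next
      case False
      then show ?thesis using part_D_D[OF y(1), of i] hh i c s by simp
    qed
    then have "D (D y) (i, j) = s \<otimes> y (i, j)"
      using j by (simp add: part_def free_on_simps(4) restrict_def fun_eq_iff) (metis lessThan_iff)
    then show ?thesis
      using ij(1) y(1) Dy s free_on_index(4)[OF ij(1) y(1)]
      by (simp add: z_def free_on_minus_index free_on_index(3))
  qed
  then obtain x where x: "x \<in> carrier G" "\<And>t. t \<in> total - parity True \<Longrightarrow> x t = \<zero>"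
    "D x = (s [^] c) \<odot>\<^bsub>G\<^esub> z"
    using Suc.IH[OF z z0] by blast
  define w where "w = (s [^] c) \<odot>\<^bsub>G\<^esub> D y \<ominus>\<^bsub>G\<^esub> x"
  have w: "w \<in> carrier G" using x Dy s by (simp add: w_def G.minus_eq)
  have "w t = \<zero>" if "t \<in> total - parity True" for t
    using that x(1,2) Dy s Dy0 by (simp add: w_def free_on_minus_index free_on_index minus_eq)
  moreover have "D w = (s [^] Suc c) \<odot>\<^bsub>G\<^esub> y"
  proof -
    have "D w = (s [^] c) \<odot>\<^bsub>G\<^esub> D (D y) \<ominus>\<^bsub>G\<^esub> (s [^] c) \<odot>\<^bsub>G\<^esub> z"
      unfolding w_def using x Dy s
      by (simp add: mod_hom_minus[OF free_on_module free_on_module D_hom] D')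
    also have "D (D y) = z \<oplus>\<^bsub>G\<^esub> s \<odot>\<^bsub>G\<^esub> y"
      using Dy y(1) s by (simp add: z_def G.minus_eq G.a_assoc G.l_neg)
    also have "(s [^] c) \<odot>\<^bsub>G\<^esub> \<dots> \<ominus>\<^bsub>G\<^esub> (s [^] c) \<odot>\<^bsub>G\<^esub> z = (s [^] c) \<odot>\<^bsub>G\<^esub> (s \<odot>\<^bsub>G\<^esub> y)"
      using z y(1) s by (simp add: G.smult_r_distr G.minus_eq G.a_ac G.r_neg1 G.r_neg2)
    also have "\<dots> = (s [^] Suc c) \<odot>\<^bsub>G\<^esub> y" using y(1) s by (simp add: G.smult_assoc1)
    finally show ?thesis .
  qed
  ultimately show ?case using w by blast
qed

text \<open>A cycle in degree \<open>r\<close>, extended by zero, lies in the kernel of \<open>D\<close> on \<open>E\<close>. In degree 0 every vector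
  is a cycle for this purpose.\<close>

lemma cycle_torsion:
  assumes noeth: "noetherian_ring R" and card: "card (parity True) \<le> card (parity False)"
  shows "\<exists>n::nat. \<forall>x\<in>carrier (F r). (r = 0 \<or> f r x = \<zero>\<^bsub>F (r - 1)\<^esub>) \<longrightarrow> (s [^] n) \<odot>\<^bsub>F r\<^esub> x = \<zero>\<^bsub>F r\<^esub>"
proof -
  let ?E = "free_on R (parity True)" and ?O = "free_on R (parity False)"
  interpret E: module R ?E by (rule free_on_module)
  define A where "A = (\<lambda>x. restrict (D (zero_extension R total (parity True) x)) (parity False))"
  have A: "A \<in> mod_hom R ?E ?O"
    unfolding A_def by (intro mod_hom_comp[OF mod_hom_comp[OF zero_extension_hom D_hom]]
        restrict_hom parity_subset)
  have surj: "\<exists>x\<in>carrier ?E. A x = (s [^] Suc r) \<odot>\<^bsub>?O\<^esub> y" if y: "y \<in> carrier ?O" for y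
  proof -
    let ?y = "zero_extension R total (parity False) y"
    have "\<exists>x\<in>carrier G. (\<forall>t\<in>total - parity True. x t = \<zero>) \<and> D x = (s [^] Suc r) \<odot>\<^bsub>G\<^esub> ?y"
      by (rule D_surjective_up_to[OF mod_homD(1)[OF zero_extension_hom y]])
        (auto simp: zero_extension_def)
    then obtain x where x: "x \<in> carrier G" "\<And>t. t \<in> total - parity True \<Longrightarrow> x t = \<zero>"
      "D x = (s [^] Suc r) \<odot>\<^bsub>G\<^esub> ?y" by blast
    have "A (restrict x (parity True)) = restrict (D x) (parity False)"
      using zero_extension_restrict[OF parity_subset x(1,2)] by (simp add: A_def)
    also have "\<dots> = (s [^] Suc r) \<odot>\<^bsub>?O\<^esub> y"
    proof (rule free_on_eqI[of _ R "parity False"])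
      show "restrict (D x) (parity False) \<in> carrier ?O"
        using mod_homD(1)[OF restrict_hom[OF parity_subset] D'(1)[OF x(1)]] .
      show "(s [^] Suc r) \<odot>\<^bsub>?O\<^esub> y \<in> carrier ?O"
        using module.smult_closed[OF free_on_module nat_pow_closed[OF s] y] .
      show "restrict (D x) (parity False) t = ((s [^] Suc r) \<odot>\<^bsub>?O\<^esub> y) t" if "t \<in> parity False" for t
        using that parity_subset[of False] unfolding x(3)
        by (auto simp: free_on_simps(4) zero_extension_def)
    qed
    finally show ?thesis
      using mod_homD(1)[OF restrict_hom[OF parity_subset] x(1)] by blast
  qed
  have "\<exists>n::nat. \<forall>x\<in>mod_kernel ?E ?O A. ((s [^] Suc r) [^] n) \<odot>\<^bsub>?E\<^esub> x = \<zero>\<^bsub>?E\<^esub>"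
    by (rule kernel_torsion_of_surjective_up_to[OF noeth finite_parity finite_parity card A
        nat_pow_closed[OF s] surj])
  then obtain n :: nat where n: "\<forall>x\<in>mod_kernel ?E ?O A. ((s [^] Suc r) [^] n) \<odot>\<^bsub>?E\<^esub> x = \<zero>\<^bsub>?E\<^esub>" ..
  have "(s [^] (Suc r * n)) \<odot>\<^bsub>F r\<^esub> x = \<zero>\<^bsub>F r\<^esub>"
    if x: "x \<in> carrier (F r)" and fx: "r = 0 \<or> f r x = \<zero>\<^bsub>F (r - 1)\<^esub>" for x
  proof -
    define w where "w = (\<lambda>t\<in>total. if fst t = r then x (snd t) else \<zero>)"
    have "x j \<in> carrier R" if "j < \<beta> r" for j using free_on_index(4)[OF _ x] that by simp
    then have w: "w \<in> carrier G" by (auto simp: w_def free_on_simps(1) total_def)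
    have Xr: "part r w = x"
      using part'(1)[OF order_refl w] x
      by (intro free_on_eqI[of _ R "{..<\<beta> r}"]) (auto simp: part_def w_def total_def)
    have Xi: "part i w = \<zero>\<^bsub>F i\<^esub>" if "i < r" for i
      using that w by (intro part_eq_zero) (auto simp: w_def total_def)
    have DX: "D w = \<zero>\<^bsub>G\<^esub>"
    proof (rule part_eqI)
      fix i assume i: "i \<le> r"
      have "fpart i w = \<zero>\<^bsub>F i\<^esub>"
      proof (cases "Suc i = r")
        case True
        then show ?thesis using Xr fx by (auto simp: fpart_def)
      next
        case False
        then show ?thesis using Xi[of "Suc i"] by (auto simp: fpart_def f_zero)
      qed
      moreover have "hpart i w = \<zero>\<^bsub>F i\<^esub>"
        using Xi[of "i - 1"] i h_zero[of "i - 1"] by (cases i) (auto simp: hpart_def)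
      ultimately show "part i (D w) = part i \<zero>\<^bsub>G\<^esub>" using part_D[OF w i] by (simp add: part_zero i)
    qed (use w D' in auto)
    have w0: "w t = \<zero>" if "t \<in> total - parity True" for t
      using that by (auto simp: w_def parity_def total_def)
    let ?z = "restrict w (parity True)"
    have z: "?z \<in> carrier ?E" using mod_homD(1)[OF restrict_hom[OF parity_subset] w] .
    have "zero_extension R total (parity True) ?z = w"
      by (rule zero_extension_restrict[OF parity_subset w w0])
    then have "A ?z = restrict \<zero>\<^bsub>G\<^esub> (parity False)" by (simp only: A_def DX)
    also have "\<dots> = \<zero>\<^bsub>?O\<^esub>"
      using parity_subset[of False] by (auto simp: free_on_simps fun_eq_iff restrict_def)
    finally have k: "((s [^] Suc r) [^] n) \<odot>\<^bsub>?E\<^esub> ?z = \<zero>\<^bsub>?E\<^esub>" using z by (intro n[rule_format]) (simp add: mod_kernel_def)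
    show ?thesis
    proof (rule free_on_eqI[of _ R "{..<\<beta> r}"])
      fix j assume "j \<in> {..<\<beta> r}"
      then have j: "(r, j) \<in> parity True" "j < \<beta> r" by (auto simp: parity_def)
      have "(((s [^] Suc r) [^] n) \<odot>\<^bsub>?E\<^esub> ?z) (r, j) = \<zero>" unfolding k using j by (simp add: free_on_index)
      moreover have "?z (r, j) = x j" using j parity_subset[of True] by (auto simp: w_def)
      ultimately have "(s [^] (Suc r * n)) \<otimes> x j = \<zero>"
        using j by (simp add: free_on_index(3) flip: nat_pow_pow[OF s] del: restrict_apply mult_Suc nat_pow_Suc)
      then show "((s [^] (Suc r * n)) \<odot>\<^bsub>F r\<^esub> x) j = \<zero>\<^bsub>F r\<^esub> j" using j by (simp add: free_on_index del: mult_Suc)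
    qed (use x s in auto)
  qed
  then show ?thesis by blast
qed

end

section \<open>Syzygies\<close>

text \<open>The usual construction of a homotopy on a projective resolution. In degree 0, \<open>s\<close> maps into the image of
  \<open>f 1\<close> because it kills \<open>M\<close>; later, \<open>s - h f\<close> maps into the cycles, which are boundaries.\<close>

lemma (in cring) exists_null_homotopy:
  assumes M: "module R M" and res: "resolution R M (\<lambda>i. free_on R {..<\<beta> i}) e f"
    and s: "s \<in> annihilator R M"
  shows "\<exists>h. null_homotopy R \<beta> f h s"
proof -
  interpret M: module R M by fact
  let ?F = "\<lambda>i. free_on R {..<\<beta> i}"
  interpret F: module R "?F i" for i by (rule free_on_module)
  have sR: "s \<in> carrier R" and sM: "\<And>x. x \<in> carrier M \<Longrightarrow> s \<odot>\<^bsub>M\<^esub> x = \<zero>\<^bsub>M\<^esub>"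
    using s by (auto simp: annihilator_def)
  have e: "e \<in> mod_hom R (?F 0) M" and im0: "f 1 ` carrier (?F 1) = mod_kernel (?F 0) M e"
    using res by (simp_all add: resolution_def)
  have f: "f (Suc i) \<in> mod_hom R (?F (Suc i)) (?F i)" for i
    using res[unfolded resolution_def] by (metis diff_Suc_1 le_add1 plus_1_eq_Suc)
  have im: "f (Suc (Suc i)) ` carrier (?F (Suc (Suc i))) = mod_kernel (?F (Suc i)) (?F i) (f (Suc i))" for i
  proof -
    have "\<forall>i\<ge>1. f (i + 1) ` carrier (?F (i + 1)) = mod_kernel (?F i) (?F (i - 1)) (f i)"
      using res by (simp add: resolution_def)
    from this[rule_format, of "Suc i"] show ?thesis by simp
  qed
  note f' = mod_homD[OF f]
  have smult: "(\<lambda>x. s \<odot>\<^bsub>?F i\<^esub> x) \<in> mod_hom R (?F i) (?F i)" for i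
    by (rule mod_hom_smult[OF free_on_module free_on_module _ sR]) (auto intro: mod_homI)
  have ff: "f (Suc i) (f (Suc (Suc i)) x) = \<zero>\<^bsub>?F i\<^esub>" if "x \<in> carrier (?F (Suc (Suc i)))" for i x
    using im[of i] that by (auto simp: mod_kernel_def)
  \<comment> \<open>The invariant needed to continue: \<open>f h = s\<close> on boundaries, which makes \<open>s - h f\<close> cycle-valued in the next
    degree. In degree 0 the equation holds everywhere, since all vectors count as cycles.\<close>
  define Pr where "Pr = (\<lambda>i h. h \<in> mod_hom R (?F i) (?F (Suc i)) \<and>
    (\<forall>y\<in>f (Suc i) ` carrier (?F (Suc i)). f (Suc i) (h y) = s \<odot>\<^bsub>?F i\<^esub> y) \<and>
    (i = 0 \<longrightarrow> (\<forall>x\<in>carrier (?F 0). f 1 (h x) = s \<odot>\<^bsub>?F 0\<^esub> x)))"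
  have "\<exists>h. \<forall>i. Pr i (h i) \<and> (\<forall>x\<in>carrier (?F (Suc i)).
      f (Suc (Suc i)) (h (Suc i) x) \<oplus>\<^bsub>?F (Suc i)\<^esub> h i (f (Suc i) x) = s \<odot>\<^bsub>?F (Suc i)\<^esub> x)"
  proof (rule dependent_nat_choice)
    have "\<exists>h\<in>mod_hom R (?F 0) (?F 1). \<forall>x\<in>carrier (?F 0). f 1 (h x) = s \<odot>\<^bsub>?F 0\<^esub> x"
    proof (rule free_on_lift[OF _ free_on_module free_on_module _ smult])
      show "f 1 \<in> mod_hom R (?F 1) (?F 0)" using f[of 0] by simp
      have "s \<odot>\<^bsub>?F 0\<^esub> x \<in> mod_kernel (?F 0) M e" if "x \<in> carrier (?F 0)" for x
        using that sR mod_homD[OF e] sM by (simp add: mod_kernel_def)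
      then show "(\<lambda>x. s \<odot>\<^bsub>?F 0\<^esub> x) ` carrier (?F 0) \<subseteq> f 1 ` carrier (?F 1)"
        unfolding im0 by blast
    qed simp
    then obtain h where h: "h \<in> mod_hom R (?F 0) (?F 1)"
      "\<forall>x\<in>carrier (?F 0). f 1 (h x) = s \<odot>\<^bsub>?F 0\<^esub> x" by blast
    have "f 1 y \<in> carrier (?F 0)" if "y \<in> carrier (?F 1)" for y using f'(1)[of y 0] that by simp
    then show "\<exists>h. Pr 0 h" using h by (auto simp: Pr_def)
  next
    fix h i assume "Pr i h"
    then have h: "h \<in> mod_hom R (?F i) (?F (Suc i))"
      and hs: "\<And>x. x \<in> carrier (?F (Suc i)) \<Longrightarrow> f (Suc i) (h (f (Suc i) x)) = s \<odot>\<^bsub>?F i\<^esub> f (Suc i) x"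
      by (auto simp: Pr_def)
    define g where "g = (\<lambda>x. s \<odot>\<^bsub>?F (Suc i)\<^esub> x \<oplus>\<^bsub>?F (Suc i)\<^esub> (\<ominus> \<one>) \<odot>\<^bsub>?F (Suc i)\<^esub> h (f (Suc i) x))"
    have g: "g \<in> mod_hom R (?F (Suc i)) (?F (Suc i))"
      unfolding g_def
      by (intro mod_hom_add mod_hom_smult free_on_module smult mod_hom_comp[OF f h]) simp
    have gm: "g x = s \<odot>\<^bsub>?F (Suc i)\<^esub> x \<ominus>\<^bsub>?F (Suc i)\<^esub> h (f (Suc i) x)" if "x \<in> carrier (?F (Suc i))" for x
      using mod_homD(1)[OF h f'(1)[OF that]] by (simp add: g_def F.smult_l_minus F.minus_eq)
    have hf: "h (f (Suc i) x) \<in> carrier (?F (Suc i))" if "x \<in> carrier (?F (Suc i))" for x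
      using mod_homD(1)[OF h f'(1)[OF that]] .
    have "g x \<in> mod_kernel (?F (Suc i)) (?F i) (f (Suc i))" if x: "x \<in> carrier (?F (Suc i))" for x
    proof -
      have sx: "s \<odot>\<^bsub>?F (Suc i)\<^esub> x \<in> carrier (?F (Suc i))" using x sR by simp
      have "f (Suc i) (g x) = s \<odot>\<^bsub>?F i\<^esub> f (Suc i) x \<ominus>\<^bsub>?F i\<^esub> s \<odot>\<^bsub>?F i\<^esub> f (Suc i) x"
        unfolding gm[OF x] mod_hom_minus[OF free_on_module free_on_module f sx hf[OF x]]
        using x sR by (simp add: f' hs)
      also have "\<dots> = \<zero>\<^bsub>?F i\<^esub>" using f'(1)[OF x] sR by (simp add: F.minus_eq F.r_neg)
      finally show ?thesis using mod_homD(1)[OF g x] by (simp add: mod_kernel_def)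
    qed
    then have "g ` carrier (?F (Suc i)) \<subseteq> f (Suc (Suc i)) ` carrier (?F (Suc (Suc i)))"
      unfolding im by blast
    then obtain k where k: "k \<in> mod_hom R (?F (Suc i)) (?F (Suc (Suc i)))"
      "\<And>x. x \<in> carrier (?F (Suc i)) \<Longrightarrow> f (Suc (Suc i)) (k x) = g x"
      using free_on_lift[OF _ free_on_module free_on_module f g] by blast
    have rel: "f (Suc (Suc i)) (k x) \<oplus>\<^bsub>?F (Suc i)\<^esub> h (f (Suc i) x) = s \<odot>\<^bsub>?F (Suc i)\<^esub> x"
      if x: "x \<in> carrier (?F (Suc i))" for x
      using k(2)[OF x] gm[OF x] hf[OF x] x sR by (simp add: F.minus_eq F.a_assoc F.l_neg)
    have "f (Suc (Suc i)) (k y) = s \<odot>\<^bsub>?F (Suc i)\<^esub> y"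
      if "y \<in> f (Suc (Suc i)) ` carrier (?F (Suc (Suc i)))" for y
    proof -
      have y: "y \<in> carrier (?F (Suc i))" and fy: "f (Suc i) y = \<zero>\<^bsub>?F i\<^esub>"
        using that ff f'(1) by auto
      show ?thesis
        using rel[OF y] fy mod_hom_zero[OF free_on_module free_on_module h]
          f'(1)[OF mod_homD(1)[OF k(1) y]] by simp
    qed
    then show "\<exists>k. Pr (Suc i) k \<and> (\<forall>x\<in>carrier (?F (Suc i)).
      f (Suc (Suc i)) (k x) \<oplus>\<^bsub>?F (Suc i)\<^esub> h (f (Suc i) x) = s \<odot>\<^bsub>?F (Suc i)\<^esub> x)"
      using k(1) rel by (intro exI[of _ k]) (simp add: Pr_def)
  qed
  then obtain h where h: "\<And>i. Pr i (h i)" "\<And>i x. x \<in> carrier (?F (Suc i)) \<Longrightarrow>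
      f (Suc (Suc i)) (h (Suc i) x) \<oplus>\<^bsub>?F (Suc i)\<^esub> h i (f (Suc i) x) = s \<odot>\<^bsub>?F (Suc i)\<^esub> x"
    by blast
  have "null_homotopy R \<beta> f h s"
  proof
    show "f 1 (h 0 x) = s \<odot>\<^bsub>?F 0\<^esub> x" if "x \<in> carrier (?F 0)" for x
      using h(1)[of 0] that by (simp add: Pr_def)
  qed (use h sR f ff in \<open>auto simp: Pr_def\<close>)
  then show ?thesis by blast
qed

text \<open>A finitely generated module which vanishes at \<open>P\<close> is killed by a single element outside \<open>P\<close>.\<close>

lemma (in cring) common_annihilating_element:
  assumes P: "primeideal P R" and I: "finite I" and N: "module R N"
    and g: "g \<in> mod_hom R (free_on R I) N"
    and tors: "\<And>x. x \<in> carrier (free_on R I) \<Longrightarrow> \<exists>u\<in>carrier R - P. u \<odot>\<^bsub>N\<^esub> g x = \<zero>\<^bsub>N\<^esub>"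
  shows "\<exists>u\<in>carrier R - P. \<forall>x\<in>carrier (free_on R I). u \<odot>\<^bsub>N\<^esub> g x = \<zero>\<^bsub>N\<^esub>"
proof -
  interpret P: primeideal P R by fact
  interpret N: module R N by fact
  interpret F: module R "free_on R I" by (rule free_on_module)
  note g' = mod_homD[OF g]
  have "\<exists>u\<in>carrier R - P. \<forall>i\<in>K. u \<odot>\<^bsub>N\<^esub> g (basis_vec R I i) = \<zero>\<^bsub>N\<^esub>" if "finite K" for K
    using that
  proof (induction K rule: finite_induct)
    case empty
    then show ?case using P.I_notcarr P.Icarr by blast
  next
    case (insert k K)
    obtain u where u: "u \<in> carrier R - P" "\<forall>i\<in>K. u \<odot>\<^bsub>N\<^esub> g (basis_vec R I i) = \<zero>\<^bsub>N\<^esub>" using insert by blast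
    obtain v where v: "v \<in> carrier R - P" "v \<odot>\<^bsub>N\<^esub> g (basis_vec R I k) = \<zero>\<^bsub>N\<^esub>"
      using tors[OF basis_vec_closed] by blast
    have gb: "g (basis_vec R I i) \<in> carrier N" for i using g'(1)[OF basis_vec_closed] .
    have "(u \<otimes> v) \<odot>\<^bsub>N\<^esub> g (basis_vec R I i) = \<zero>\<^bsub>N\<^esub>" if "i \<in> insert k K" for i
    proof (cases "i = k")
      case True
      then show ?thesis using u v gb by (simp add: N.smult_assoc1)
    next
      case False
      have "(u \<otimes> v) \<odot>\<^bsub>N\<^esub> g (basis_vec R I i) = v \<odot>\<^bsub>N\<^esub> (u \<odot>\<^bsub>N\<^esub> g (basis_vec R I i))"
        using u(1) v(1) gb by (simp add: m_comm flip: N.smult_assoc1)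
      then show ?thesis using False that u v(1) by simp
    qed
    moreover have "u \<otimes> v \<in> carrier R - P" using u(1) v(1) P.I_prime[of u v] by auto
    ultimately show ?case by blast
  qed
  then obtain u where u: "u \<in> carrier R - P" "\<And>i. i \<in> I \<Longrightarrow> u \<odot>\<^bsub>N\<^esub> g (basis_vec R I i) = \<zero>\<^bsub>N\<^esub>"
    using I by blast
  have uR: "u \<in> carrier R" using u(1) by blast
  have "u \<odot>\<^bsub>N\<^esub> g x = \<zero>\<^bsub>N\<^esub>" if x: "x \<in> carrier (free_on R I)" for x
    using I x
  proof (induction rule: free_on_induct)
    case zero
    then show ?case using uR by (simp add: mod_hom_zero[OF free_on_module N g])
  next
    case (add y z)
    then show ?case using uR by (simp add: g' N.smult_r_distr)
  next
    case (basis i)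
    have xi: "x i \<in> carrier R" using free_on_index(4)[OF basis x] .
    have gb: "g (basis_vec R I i) \<in> carrier N" using g'(1)[OF basis_vec_closed] .
    have "u \<odot>\<^bsub>N\<^esub> g (x i \<odot>\<^bsub>free_on R I\<^esub> basis_vec R I i) = u \<odot>\<^bsub>N\<^esub> (x i \<odot>\<^bsub>N\<^esub> g (basis_vec R I i))"
      using xi by (simp add: g' basis_vec_closed)
    also have "\<dots> = x i \<odot>\<^bsub>N\<^esub> (u \<odot>\<^bsub>N\<^esub> g (basis_vec R I i))"
      using uR xi gb by (simp add: m_comm flip: N.smult_assoc1)
    finally show ?case using u(2)[OF basis] xi by simp
  qed
  then show ?thesis using u(1) by blast
qed

lemma syzygy_cycles_boundaries:
  fixes R (structure) and r :: nat
  assumes R: "cring R" and M: "module R M"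
    and res: "resolution R M (\<lambda>i. free_on R {..<\<beta> i}) e f"
  defines "S \<equiv> carrier (syzygy R M \<beta> e f (r + 1))"
  shows "syzygy R M \<beta> e f (r + 1) = (free_on R {..<\<beta> r})\<lparr>carrier := S\<rparr>"
    and "submodule S R (free_on R {..<\<beta> r})"
    and "S = f (Suc r) ` carrier (free_on R {..<\<beta> (Suc r)})"
    and "f (Suc r) \<in> mod_hom R (free_on R {..<\<beta> (Suc r)}) (free_on R {..<\<beta> r})"
    and "x \<in> S \<Longrightarrow> r = 0 \<or> f r x = \<zero>\<^bsub>free_on R {..<\<beta> (r - 1)}\<^esub>"
proof -
  interpret cring R by (rule R)
  let ?F = "\<lambda>i. free_on R {..<\<beta> i}"
  have S: "S = (if r = 0 then mod_kernel (?F 0) M e else mod_kernel (?F r) (?F (r - 1)) (f r))"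
    by (simp add: S_def syzygy_def free_module_eq)
  have e: "e \<in> mod_hom R (?F 0) M" and f: "\<forall>i\<ge>1. f i \<in> mod_hom R (?F i) (?F (i - 1))"
    and im0: "f 1 ` carrier (?F 1) = mod_kernel (?F 0) M e"
    and im: "\<forall>i\<ge>1. f (i + 1) ` carrier (?F (i + 1)) = mod_kernel (?F i) (?F (i - 1)) (f i)"
    using res by (simp_all add: resolution_def)
  show "syzygy R M \<beta> e f (r + 1) = (?F r)\<lparr>carrier := S\<rparr>"
    by (simp add: S_def syzygy_def free_module_eq)
  show "submodule S R (?F r)"
    using submodule_kernel[OF free_on_module M e]
      submodule_kernel[OF free_on_module free_on_module f[rule_format, of r]]
    by (auto simp: S)
  show "S = f (Suc r) ` carrier (?F (Suc r))" using im0 im[rule_format, of r] by (cases "r = 0") (auto simp: S)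
  show "f (Suc r) \<in> mod_hom R (?F (Suc r)) (?F r)" using f[rule_format, of "Suc r"] by simp
  show "x \<in> S \<Longrightarrow> r = 0 \<or> f r x = \<zero>\<^bsub>?F (r - 1)\<^esub>" by (auto simp: S mod_kernel_def)
qed

text \<open>The ranks are compared with the help of one element \<open>b\<close> of \<open>\<mm>\<close> outside \<open>P\<close>. The result of the comparison
  is then used for the homotopy belonging to \<open>a\<close>.\<close>

lemma syzygy_torsion_of_not_in_Supp:
  fixes R (structure)
  assumes noeth: "noetherian_ring R" and loc: "local_ring R \<mm>" and M: "module R M"
    and len: "module_length R M < \<infinity>"
    and res: "resolution R M (\<lambda>i. free_on R {..<\<beta> i}) e f"
    and P: "P \<in> Spec R" "P \<notin> Supp R (syzygy R M \<beta> e f (r + 1))"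
    and a: "a \<in> \<mm>" and x: "x \<in> carrier (syzygy R M \<beta> e f (r + 1))"
  shows "\<exists>k::nat. (a [^] k) \<odot>\<^bsub>free_on R {..<\<beta> r}\<^esub> x = \<zero>\<^bsub>free_on R {..<\<beta> r}\<^esub>"
proof -
  interpret cring R using loc by (simp add: local_ring_def)
  interpret m: maximalideal \<mm> R using loc by (simp add: local_ring_def)
  interpret P: primeideal P R using P(1) by (simp add: Spec_def)
  interpret M: module R M by (rule M)
  let ?F = "\<lambda>i. free_on R {..<\<beta> i}"
  interpret F: module R "?F i" for i by (rule free_on_module)
  define S where "S = carrier (syzygy R M \<beta> e f (r + 1))"
  note syz = syzygy_cycles_boundaries[OF is_cring M res, where r = r, folded S_def]
  have xS: "x \<in> S" using x by (simp add: S_def)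
  have SF: "S \<subseteq> carrier (?F r)" using F.submoduleE(1)[OF syz(2)] .
  have S_mod: "module R (syzygy R M \<beta> e f (r + 1))"
    unfolding syz(1) by (rule submodule.submodule_is_module[OF syz(2) free_on_module])
  have tors: "\<exists>u\<in>carrier R - P. u \<odot>\<^bsub>?F r\<^esub> y = \<zero>\<^bsub>?F r\<^esub>" if "y \<in> S" for y
    using iffD1[OF not_in_Supp_iff[OF S_mod P(1)] P(2)] that unfolding syz(1) by simp
  show ?thesis
  proof (cases "\<mm> \<subseteq> P")
    case True
    \<comment> \<open>Elements outside \<open>\<mm>\<close> are units, so the syzygy is zero.\<close>
    then have "P = \<mm>" using m.I_maximal[OF P.is_ideal] P.a_subset P.I_notcarr by blast
    then obtain u where u: "u \<in> carrier R" "u \<notin> \<mm>" "u \<odot>\<^bsub>?F r\<^esub> x = \<zero>\<^bsub>?F r\<^esub>" using tors[OF xS] by blast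
    have uU: "u \<in> Units R" by (rule local_ring_unit[OF noeth loc u(1,2)])
    have xF: "x \<in> carrier (?F r)" using xS SF by blast
    have "x = inv u \<odot>\<^bsub>?F r\<^esub> (u \<odot>\<^bsub>?F r\<^esub> x)" using uU u(1) xF by (simp flip: F.smult_assoc1)
    then have "x = \<zero>\<^bsub>?F r\<^esub>" using u(3) uU by simp
    then show ?thesis using m.Icarr[OF a] by auto
  next
    case False
    then obtain b where b: "b \<in> \<mm>" "b \<notin> P" by blast
    obtain n :: nat where n: "\<And>a. a \<in> \<mm> \<Longrightarrow> a [^] n \<in> annihilator R M"
      using M.finite_length_nilpotent[OF noeth loc len] m.Icarr by (auto simp: annihilator_def)
    obtain h where h: "null_homotopy R \<beta> f h (b [^] n)"
      using exists_null_homotopy[OF M res n[OF b(1)]] by blast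
    obtain u where u: "u \<in> carrier R - P" "\<And>y. y \<in> S \<Longrightarrow> u \<odot>\<^bsub>?F r\<^esub> y = \<zero>\<^bsub>?F r\<^esub>"
      using common_annihilating_element[OF P.primeideal_axioms _ free_on_module syz(4)] tors
      unfolding syz(3) by auto
    interpret B: null_homotopy R \<beta> f h "b [^] n" r by (rule h)
    have card: "card (B.parity True) \<le> card (B.parity False)"
    proof (rule B.card_parity_le[OF P.primeideal_axioms])
      show "b [^] n \<notin> P" using primeideal_nat_pow[OF P.primeideal_axioms m.Icarr[OF b(1)]] b(2) by blast
      show "u \<in> carrier R" "u \<notin> P" using u(1) by auto
      show "u \<odot>\<^bsub>?F r\<^esub> B.hf z = u \<odot>\<^bsub>?F r\<^esub> (b [^] n \<odot>\<^bsub>?F r\<^esub> z)" if z: "z \<in> carrier (?F r)" for z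
      proof -
        have uR: "u \<in> carrier R" using u(1) by blast
        have sz: "b [^] n \<odot>\<^bsub>?F r\<^esub> z \<in> carrier (?F r)" using z B.s by simp
        show ?thesis
        proof (cases r)
          case 0
          have "e z \<in> carrier M" "e \<in> mod_hom R (?F 0) M"
            using res z 0 by (auto simp: resolution_def mod_hom_def)
          then have "e (b [^] n \<odot>\<^bsub>?F 0\<^esub> z) = \<zero>\<^bsub>M\<^esub>"
            using n[OF b(1)] mod_homD(3)[of e R "?F 0" M "b [^] n" z] z 0 by (auto simp: annihilator_def)
          then have "b [^] n \<odot>\<^bsub>?F r\<^esub> z \<in> S"
            using sz 0 by (simp add: S_def syzygy_def free_module_eq mod_kernel_def)
          then show ?thesis using u(2) uR by (simp add: B.hf_0[OF 0])
        next
          case (Suc k)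
          have zk: "z \<in> carrier (?F (Suc k))" using z Suc by simp
          have hc: "h k (f (Suc k) z) \<in> carrier (?F (Suc k))" using zk by (simp add: B.f' B.h')
          have fc: "f (Suc (Suc k)) (h (Suc k) z) \<in> carrier (?F (Suc k))" using zk by (simp add: B.f' B.h')
          \<comment> \<open>This is the error term, the difference between \<open>s\<close> and \<open>h f\<close> on \<open>F r\<close>.\<close>
          have "f (Suc r) (h r z) \<in> S" unfolding syz(3) using B.h'(1)[OF z] by blast
          then have "u \<odot>\<^bsub>?F r\<^esub> f (Suc r) (h r z) = \<zero>\<^bsub>?F r\<^esub>" by (rule u(2))
          moreover have "u \<odot>\<^bsub>?F (Suc k)\<^esub> (b [^] n \<odot>\<^bsub>?F (Suc k)\<^esub> z) =
            u \<odot>\<^bsub>?F (Suc k)\<^esub> f (Suc (Suc k)) (h (Suc k) z) \<oplus>\<^bsub>?F (Suc k)\<^esub> u \<odot>\<^bsub>?F (Suc k)\<^esub> h k (f (Suc k) z)"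
            unfolding B.fh_Suc[OF zk, symmetric] using uR hc fc by (simp add: F.smult_r_distr)
          ultimately show ?thesis using uR hc unfolding B.hf_Suc[OF Suc] by (simp add: Suc)
        qed
      qed
    qed
    obtain h' where h': "null_homotopy R \<beta> f h' (a [^] n)"
      using exists_null_homotopy[OF M res n[OF a]] by blast
    interpret A: null_homotopy R \<beta> f h' "a [^] n" r by (rule h')
    obtain k :: nat where "(a [^] n) [^] k \<odot>\<^bsub>?F r\<^esub> x = \<zero>\<^bsub>?F r\<^esub>"
      using A.cycle_torsion[OF noeth] card xS SF syz(5)[OF xS] by blast
    then show ?thesis using m.Icarr[OF a] by (auto simp: nat_pow_pow)
  qed
qed

theorem mainTheorem2:
  fixes R :: "('a, 'r) ring_scheme" and \<mm> :: "'a set" and d r :: nat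
    and M :: "('a, 'b, 'm) module_scheme"
    and \<beta> :: "nat \<Rightarrow> nat"
    and e :: "(nat \<Rightarrow> 'a) \<Rightarrow> 'b"
    and f :: "nat \<Rightarrow> (nat \<Rightarrow> 'a) \<Rightarrow> (nat \<Rightarrow> 'a)"
  assumes "noetherian_ring R" and "local_ring R \<mm>"
    and "krull_dim R = ereal (real d)" and "d > 0"
    and "module R M" and "carrier M \<noteq> {\<zero>\<^bsub>M\<^esub>}"
    and "module_length R M < \<infinity>"
    and "proj_dim R M = \<infinity>"
    and "minimal_free_resolution R \<mm> M \<beta> e f"
  shows "(Supp R (syzygy R M \<beta> e f (r + 1)) = Spec R \<longleftrightarrow>
            module_dim R (syzygy R M \<beta> e f (r + 1)) = krull_dim R) \<and>
         (module_dim R (syzygy R M \<beta> e f (r + 1)) = krull_dim R \<longleftrightarrow>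
            module_length R (syzygy R M \<beta> e f (r + 1)) = \<infinity>)"
proof -
  interpret cring R using assms(2) by (simp add: local_ring_def)
  have max: "maximalideal \<mm> R" using assms(2) by (simp add: local_ring_def)
  have res: "resolution R M (\<lambda>i. free_on R {..<\<beta> i}) e f"
    using assms(9) by (simp add: minimal_free_resolution_def free_module_eq)
  let ?S = "syzygy R M \<beta> e f (r + 1)"
  note syz = syzygy_cycles_boundaries[OF is_cring assms(5) res, where r = r]
  have S: "module R ?S"
    by (subst syz(1)) (rule submodule.submodule_is_module[OF syz(2) free_on_module])
  note ann = ideal_annihilator[OF S]
  have i_ii: "module_dim R ?S = krull_dim R" if "Supp R ?S = Spec R"
    unfolding module_dim_def
    by (rule krull_dim_quotient_eq[OF is_cring ann]) (use annihilator_subset_of_Supp[OF S] that in blast)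
  have ii_iii: "module_length R ?S = \<infinity>" if dim: "module_dim R ?S = krull_dim R"
  proof (rule ccontr)
    assume "module_length R ?S \<noteq> \<infinity>"
    then have "module_length R ?S < \<infinity>" by (simp add: enat_ord_simps(4))
    then obtain n :: nat where n: "\<forall>a\<in>\<mm>. \<forall>x\<in>carrier ?S. (a [^]\<^bsub>R\<^esub> n) \<odot>\<^bsub>?S\<^esub> x = \<zero>\<^bsub>?S\<^esub>"
      using module.finite_length_nilpotent[OF S assms(1,2)] by blast
    have "krull_dim (R Quot annihilator R ?S) \<le> 0"
    proof (rule krull_dim_quotient_nonpos[OF is_cring ann max])
      show "\<exists>n::nat. a [^]\<^bsub>R\<^esub> n \<in> annihilator R ?S" if a: "a \<in> \<mm>" for a
        using n a ideal.Icarr[OF maximalideal.axioms(1)[OF max] a] by (auto simp: annihilator_def)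
    qed
    then show False using dim assms(3,4) by (simp add: module_dim_def)
  qed
  have iii_i: "Supp R ?S = Spec R" if len: "module_length R ?S = \<infinity>"
  proof (rule ccontr)
    assume "Supp R ?S \<noteq> Spec R"
    then obtain P where P: "P \<in> Spec R" "P \<notin> Supp R ?S" by (auto simp: Supp_def)
    have "module_length R ((free_on R {..<\<beta> r})\<lparr>carrier := carrier ?S\<rparr>) < \<infinity>"
      by (rule nilpotent_imp_finite_length[OF assms(1,2) _ syz(2)])
        (auto intro: syzygy_torsion_of_not_in_Supp[OF assms(1,2,5,7) res P])
    then show False using len syz(1) by simp
  qed
  show ?thesis using i_ii ii_iii iii_i by blast
qed

end
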